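(* Let $ABC \subset \mathbb{H}^2$ be a nondegenerate hyperbolic triangle whose internal angles at $A$, $B$, $C$ have radian measures $\alpha$, $\beta$, $\gamma$, and suppose that $\alpha,\beta,\gamma\in\mathbb{Q}\pi$. Then every side length of $ABC$ is transcendental over $\mathbb{Q}$.
   Context: $\mathbb{H}^2$ denotes the hyperbolic plane of constant Gaussian curvature $K=-1$; side lengths are hyperbolic lengths. $\mathbb{Q}\pi$ denotes the set of rational multiples of $\pi$; an angle is called rational if its radian measure lies in $\mathbb{Q}\pi$. Nondegenerate means that the three vertices are noncollinear (not on a common geodesic). Algebraic and transcendental mean over $\mathbb{Q}$. *)

theory Defs
  imports "HOL-Analysis.Analysis" "HOL-Computational_Algebra.Polynomial"
begin

text \<open>
  The hyperbolic plane of curvature \<open>-1\<close> is taken in the hyperboloid model: the upper sheet of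
  \<open>\<langle>x, x\<rangle> = -1\<close> in Lorentzian 3-space. The Riemannian metric at a point is the restriction of
  the Lorentzian form to the tangent plane there, which is positive definite
  (\<open>lorentz_tangent_pos\<close>).
\<close>

definition lorentz :: "real^3 \<Rightarrow> real^3 \<Rightarrow> real" where
  "lorentz x y = x$1 * y$1 + x$2 * y$2 - x$3 * y$3"

definition hyp_plane :: "(real^3) set" where
  "hyp_plane = {x. lorentz x x = -1 \<and> x$3 > 0}"

definition hyp_tangent :: "real^3 \<Rightarrow> (real^3) set" where
  "hyp_tangent p = {v. lorentz p v = 0}"

definition hyp_unit_tangent :: "real^3 \<Rightarrow> (real^3) set" where
  "hyp_unit_tangent p = {v \<in> hyp_tangent p. lorentz v v = 1}"

text \<open>The unit-speed geodesic that starts at \<open>p\<close> with velocity \<open>v \<in> hyp_unit_tangent p\<close>.\<close>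

definition hyp_geodesic :: "real^3 \<Rightarrow> real^3 \<Rightarrow> real \<Rightarrow> real^3" where
  "hyp_geodesic p v t = cosh t *\<^sub>R p + sinh t *\<^sub>R v"

definition hyp_collinear :: "(real^3) set \<Rightarrow> bool" where
  "hyp_collinear S \<longleftrightarrow>
     (\<exists>p\<in>hyp_plane. \<exists>v\<in>hyp_unit_tangent p. S \<subseteq> range (hyp_geodesic p v))"

definition hyp_dist :: "real^3 \<Rightarrow> real^3 \<Rightarrow> real" where
  "hyp_dist p q = arcosh (- lorentz p q)"

text \<open>
  The initial velocity of the unit-speed geodesic segment from \<open>p\<close> to \<open>q\<close>. It is well defined for
  distinct points of the plane (\<open>hyp_direction_unique\<close>) and meaningless for \<open>p = q\<close>.
\<close>

definition hyp_direction :: "real^3 \<Rightarrow> real^3 \<Rightarrow> real^3" where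
  "hyp_direction p q = (THE v. v \<in> hyp_unit_tangent p \<and> (\<exists>t>0. q = hyp_geodesic p v t))"

text \<open>The angle at \<open>B\<close> between the segments \<open>BA\<close> and \<open>BC\<close>; the vertex is the middle argument.\<close>

definition hyp_angle :: "real^3 \<Rightarrow> real^3 \<Rightarrow> real^3 \<Rightarrow> real" where
  "hyp_angle A B C = arccos (lorentz (hyp_direction B A) (hyp_direction B C))"

definition rational_angle :: "real \<Rightarrow> bool" where
  "rational_angle \<theta> \<longleftrightarrow> (\<exists>r\<in>\<rat>. \<theta> = r * pi)"


lemma lorentz_tangent_bound:
  assumes "p \<in> hyp_plane" "v \<in> hyp_tangent p"
  shows "(v$3)\<^sup>2 \<le> ((p$3)\<^sup>2 - 1) * lorentz v v"
proof -
  have p: "(p$3)\<^sup>2 = 1 + (p$1)\<^sup>2 + (p$2)\<^sup>2"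
    using assms by (simp add: hyp_plane_def lorentz_def power2_eq_square)
  have v: "p$3 * v$3 = p$1 * v$1 + p$2 * v$2"
    using assms by (simp add: hyp_tangent_def lorentz_def)
  have "((p$3)\<^sup>2 - 1) * lorentz v v - (v$3)\<^sup>2
      = ((p$1)\<^sup>2 + (p$2)\<^sup>2) * ((v$1)\<^sup>2 + (v$2)\<^sup>2) - (p$3 * v$3)\<^sup>2"
    unfolding p power_mult_distrib by (simp add: lorentz_def algebra_simps power2_eq_square)
  also have "\<dots> = (p$1 * v$2 - p$2 * v$1)\<^sup>2"
    unfolding v by (simp add: algebra_simps power2_eq_square)
  finally show ?thesis
    by (smt (verit) zero_le_power2)
qed

lemma lorentz_tangent_pos:
  assumes "p \<in> hyp_plane" "v \<in> hyp_tangent p" "v \<noteq> 0"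
  shows "lorentz v v > 0"
proof (cases "v$3 = 0")
  case True
  then have "v$1 \<noteq> 0 \<or> v$2 \<noteq> 0"
    using assms(3) by (auto simp: vec_eq_iff forall_3)
  then show ?thesis
    using True by (simp add: lorentz_def sum_squares_gt_zero_iff)
next
  case False
  have "(p$3)\<^sup>2 - 1 \<ge> 0"
    using assms(1) by (simp add: hyp_plane_def lorentz_def power2_eq_square)
      (smt (verit) zero_le_square)
  moreover have "0 < ((p$3)\<^sup>2 - 1) * lorentz v v"
    using lorentz_tangent_bound[OF assms(1,2)] False by (smt (verit) zero_less_power2)
  ultimately show ?thesis
    by (smt (verit) zero_less_mult_iff)
qed

lemma lorentz_geodesic:
  assumes "p \<in> hyp_plane" "v \<in> hyp_unit_tangent p"
  shows "lorentz p (hyp_geodesic p v t) = - cosh t"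
    and "lorentz (hyp_geodesic p v t) (hyp_geodesic p v t) = -1"
proof -
  have lin: "lorentz p (a *\<^sub>R p + b *\<^sub>R v) = a * lorentz p p + b * lorentz p v"
    and quad: "lorentz (a *\<^sub>R p + b *\<^sub>R v) (a *\<^sub>R p + b *\<^sub>R v)
      = a\<^sup>2 * lorentz p p + 2 * a * b * lorentz p v + b\<^sup>2 * lorentz v v" for a b
    by (simp_all add: lorentz_def algebra_simps power2_eq_square)
  have *: "lorentz p p = -1" "lorentz p v = 0" "lorentz v v = 1"
    using assms by (auto simp: hyp_plane_def hyp_unit_tangent_def hyp_tangent_def)
  show "lorentz p (hyp_geodesic p v t) = - cosh t"
    by (simp add: hyp_geodesic_def lin *)
  show "lorentz (hyp_geodesic p v t) (hyp_geodesic p v t) = -1"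
    by (simp add: hyp_geodesic_def quad * cosh_square_eq)
qed

lemma hyp_geodesic_in_plane:
  assumes "p \<in> hyp_plane" "v \<in> hyp_unit_tangent p"
  shows "hyp_geodesic p v t \<in> hyp_plane"
proof -
  have p3: "p$3 > 0"
    using assms by (simp add: hyp_plane_def)
  have "(v$3)\<^sup>2 < (p$3)\<^sup>2"
    using lorentz_tangent_bound[of p v] assms by (simp add: hyp_unit_tangent_def)
  then have "\<bar>v$3\<bar> < p$3"
    using p3 by (metis abs_of_pos power2_less_imp_less power2_abs less_imp_le)
  moreover have "\<bar>sinh t\<bar> < cosh t"
    by (metis cosh_real_nonneg cosh_square_eq less_add_one power2_abs power2_less_imp_less)
  ultimately have "\<bar>sinh t * v$3\<bar> < cosh t * p$3"
    by (simp add: abs_mult abs_mult_less)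
  then show ?thesis
    using lorentz_geodesic(2)[OF assms] by (simp add: hyp_plane_def hyp_geodesic_def)
qed

lemma hyp_dist_geodesic:
  assumes "p \<in> hyp_plane" "v \<in> hyp_unit_tangent p"
  shows "hyp_dist p (hyp_geodesic p v t) = \<bar>t\<bar>"
  using arcosh_cosh_real[of "\<bar>t\<bar>"]
  by (simp add: hyp_dist_def lorentz_geodesic[OF assms])

lemma lorentz_less_minus_one:
  assumes "p \<in> hyp_plane" "q \<in> hyp_plane" "p \<noteq> q"
  shows "lorentz p q < -1"
proof -
  have p: "(p$3)\<^sup>2 = 1 + (p$1)\<^sup>2 + (p$2)\<^sup>2" "p$3 > 0"
   and q: "(q$3)\<^sup>2 = 1 + (q$1)\<^sup>2 + (q$2)\<^sup>2" "q$3 > 0"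
    using assms by (simp_all add: hyp_plane_def lorentz_def power2_eq_square)
  have "p$1 \<noteq> q$1 \<or> p$2 \<noteq> q$2"
  proof (rule ccontr)
    assume "\<not> ?thesis"
    moreover from this have "p$3 = q$3"
      using p q by (metis less_imp_le power2_eq_iff_nonneg)
    ultimately show False
      using assms(3) by (auto simp: vec_eq_iff forall_3)
  qed
  then have "0 < (p$1 - q$1)\<^sup>2 + (p$2 - q$2)\<^sup>2"
    by (simp add: sum_power2_gt_zero_iff)
  also have "\<dots> \<le> (p$1 - q$1)\<^sup>2 + (p$2 - q$2)\<^sup>2 + (p$1 * q$2 - p$2 * q$1)\<^sup>2"
    by simp
  also have "\<dots> = (p$3 * q$3)\<^sup>2 - (1 + (p$1 * q$1 + p$2 * q$2))\<^sup>2"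
    unfolding power_mult_distrib p q by (simp add: algebra_simps power2_eq_square)
  finally have "(1 + (p$1 * q$1 + p$2 * q$2))\<^sup>2 < (p$3 * q$3)\<^sup>2"
    by simp
  then have "1 + (p$1 * q$1 + p$2 * q$2) < p$3 * q$3"
    by (rule power2_less_imp_less) (use p(2) q(2) in simp)
  then show ?thesis
    by (simp add: lorentz_def)
qed

lemma hyp_direction_unique:
  assumes "p \<in> hyp_plane" "q \<in> hyp_plane" "p \<noteq> q"
  shows "\<exists>!v. v \<in> hyp_unit_tangent p \<and> (\<exists>t>0. q = hyp_geodesic p v t)"
proof (rule ex_ex1I)
  define d where "d = hyp_dist p q"
  define v where "v = (1 / sinh d) *\<^sub>R (q - cosh d *\<^sub>R p)"
  have lin: "lorentz p (a *\<^sub>R (q - b *\<^sub>R p)) = a * (lorentz p q - b * lorentz p p)"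
    and quad: "lorentz (a *\<^sub>R (q - b *\<^sub>R p)) (a *\<^sub>R (q - b *\<^sub>R p))
      = a\<^sup>2 * (lorentz q q - 2 * b * lorentz p q + b\<^sup>2 * lorentz p p)" for a b
    by (simp_all add: lorentz_def algebra_simps power2_eq_square)
  have l: "- lorentz p q > 1"
    using lorentz_less_minus_one[OF assms] by simp
  have c: "cosh d = - lorentz p q"
    using l by (simp add: d_def hyp_dist_def)
  have "d \<noteq> 0"
    using c l by auto
  moreover have "d \<ge> 0"
    using l by (simp add: d_def hyp_dist_def)
  ultimately have d: "d > 0" "sinh d \<noteq> 0"
    by auto
  have "q = hyp_geodesic p v d"
    using d by (simp add: hyp_geodesic_def v_def)
  moreover have "lorentz p v = 0"
  proof -
    have "lorentz p v = (lorentz p q - cosh d * lorentz p p) / sinh d"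
      by (simp add: v_def lin)
    then show ?thesis
      using assms(1) c by (simp add: hyp_plane_def)
  qed
  moreover have "lorentz v v = 1"
  proof -
    have "lorentz v v
        = (lorentz q q - 2 * cosh d * lorentz p q + (cosh d)\<^sup>2 * lorentz p p) / (sinh d)\<^sup>2"
      by (simp add: v_def quad power_one_over)
    also have "\<dots> = ((cosh d)\<^sup>2 - 1) / (sinh d)\<^sup>2"
      using assms c by (simp add: hyp_plane_def power2_eq_square)
    finally show ?thesis
      using d by (simp add: cosh_square_eq)
  qed
  ultimately show "\<exists>v. v \<in> hyp_unit_tangent p \<and> (\<exists>t>0. q = hyp_geodesic p v t)"
    using d by (auto simp: hyp_unit_tangent_def hyp_tangent_def)
next
  fix v w
  assume "v \<in> hyp_unit_tangent p \<and> (\<exists>t>0. q = hyp_geodesic p v t)"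
    and "w \<in> hyp_unit_tangent p \<and> (\<exists>t>0. q = hyp_geodesic p w t)"
  then obtain s t where st: "s > 0" "t > 0" "q = hyp_geodesic p v s" "q = hyp_geodesic p w t"
    and vw: "v \<in> hyp_unit_tangent p" "w \<in> hyp_unit_tangent p"
    by auto
  have "s = t"
    using hyp_dist_geodesic[OF assms(1) vw(1), of s] hyp_dist_geodesic[OF assms(1) vw(2), of t] st
    by simp
  then show "v = w"
    using st by (simp add: hyp_geodesic_def)
qed

end

theory Submission
  imports Defs "HOL-Complex_Analysis.Complex_Analysis"
begin

text \<open>
  In hyperbolic geometry the angles of a triangle determine its sides. By the dual law of cosines
  (\<open>hyperbolic_dual_law_of_cosines_squared\<close>), the hyperbolic cosine of a side is an algebraic
  expression in the cosines of the angles. Cosines of rational angles are algebraic, so the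
  exponential of every side is algebraic (\<open>algebraic_exp_side_of_rational_angles\<close>). By the theorem
  of Hermite and Lindemann (\<open>hermite_lindemann\<close>), \<open>exp d\<close> is transcendental for every nonzero algebraic
  \<open>d\<close>. Hence a side, being positive, is not algebraic.

  The Hermite-Lindemann theorem is proved without conjugates and symmetric functions. Suppose that
  \<open>a\<close> and \<open>exp a\<close> are both algebraic. Up to a bounded denominator, they lie in a ring \<open>R\<close> that
  is finitely generated as an abelian group. In such a ring there is a Liouville inequality
  (\<open>liouville_inequality\<close>): if a nonzero \<open>x\<close> has an integer representation with coefficients of
  size \<open>H\<close>, then \<open>\<bar>x\<bar>\<close> is at least a constant times \<open>H\<close> to a power \<open>-E\<close> that depends on \<open>R\<close> only.
  This follows from Siegel's lemma, applied to the powers of \<open>x\<close>, and the same relation shows that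
  all elements of \<open>R\<close> are algebraic, which gives the closure of the algebraic numbers under sums
  and products.

  The elements that violate this inequality are the integrals of
  \<open>z ^ r exp(a z) / (z (z - 1) \<dots> (z - m)) ^ n\<close> over a circle around all poles, for \<open>r \<le> m\<close>. Their residues
  at the nodes are \<open>exp(a j)\<close> times polynomials in \<open>a\<close>, so a multiple of the integral lies in \<open>R\<close>
  and has height at most \<open>(K n) ^ n\<close> (\<open>scaled_hermite_integral_height\<close>). On a circle of radius
  \<open>n + m\<close> the integrand is of the order \<open>K ^ n / n ^ ((m + 1) n)\<close>, so the same multiple is extremely
  small (\<open>scaled_hermite_integral_small\<close>). Not all of the \<open>m + 1\<close> integrals vanish, because
  integration by parts would propagate this to all numerators (\<open>hermite_integral_nonvanishing\<close>).
  For \<open>m > E\<close> and large \<open>n\<close> a nonzero one contradicts the Liouville inequality.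
\<close>

section \<open>Heights in finitely generated rings and a Liouville inequality\<close>

text \<open>
  The pigeonhole form of Siegel's lemma: there are more vectors \<open>c\<close> with entries in \<open>{0..B}\<close> than
  possible values of their images, so two of them have the same image, and their difference lies
  in the kernel. The value of \<open>B\<close> is chosen so that \<open>(2 (D + 1) G) ^ D (B + 1) ^ D\<close>, which bounds the
  number of images, is \<open>B (B + 1) ^ D < (B + 1) ^ (D + 1)\<close>.
\<close>

lemma small_integer_kernel_vector:
  fixes q :: "nat \<Rightarrow> 'i \<Rightarrow> int" and G :: nat
  assumes "finite I" and D: "D = card I" and "G \<ge> 1"
    and q: "\<And>k i. k \<le> D \<Longrightarrow> i \<in> I \<Longrightarrow> \<bar>q k i\<bar> \<le> int G"
  obtains c :: "nat \<Rightarrow> int" where "\<exists>k\<le>D. c k \<noteq> 0"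
    "\<And>k. k \<le> D \<Longrightarrow> \<bar>c k\<bar> \<le> int ((2 * (D + 1) * G) ^ D)"
    "\<And>i. i \<in> I \<Longrightarrow> (\<Sum>k\<le>D. c k * q k i) = 0"
proof -
  define B where "B = (2 * (D + 1) * G) ^ D"
  define S where "S = (D + 1) * B * G"
  define A where "A = {..D} \<rightarrow>\<^sub>E {..B}"
  define V where "V = I \<rightarrow>\<^sub>E {- int S..int S}"
  define f where "f c = (\<lambda>i\<in>I. \<Sum>k\<le>D. int (c k) * q k i)" for c
  have "f c \<in> V" if c: "c \<in> A" for c
  proof -
    have "\<bar>\<Sum>k\<le>D. int (c k) * q k i\<bar> \<le> int S" if i: "i \<in> I" for i
    proof -
      have "\<bar>\<Sum>k\<le>D. int (c k) * q k i\<bar> \<le> (\<Sum>k\<le>D. \<bar>int (c k) * q k i\<bar>)"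
        by (rule sum_abs)
      also have "\<dots> \<le> (\<Sum>k\<le>D. int B * int G)"
        using c q i by (intro sum_mono) (auto simp: abs_mult A_def PiE_def Pi_def intro!: mult_mono)
      also have "\<dots> = int S" by (simp add: S_def algebra_simps)
      finally show ?thesis .
    qed
    then have "- int S \<le> (\<Sum>k\<le>D. int (c k) * q k i) \<and> (\<Sum>k\<le>D. int (c k) * q k i) \<le> int S"
      if "i \<in> I" for i
      using that by (metis abs_le_iff minus_le_iff)
    then show ?thesis unfolding f_def V_def by auto
  qed
  then have "f ` A \<subseteq> V" by auto
  moreover have "finite V" unfolding V_def using assms(1) by (intro finite_PiE) auto
  ultimately have "card (f ` A) \<le> card V" by (rule card_mono[rotated])
  also have "card V = (2 * S + 1) ^ D"
    unfolding V_def using assms(1) D by (simp add: card_PiE nat_add_distrib nat_mult_distrib)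
  also have "\<dots> \<le> (2 * (D + 1) * G * (B + 1)) ^ D"
  proof (rule power_mono)
    have "1 \<le> 2 * (D + 1) * G" using assms(3) by simp
    then show "2 * S + 1 \<le> 2 * (D + 1) * G * (B + 1)"
      unfolding S_def by (simp add: algebra_simps)
  qed simp
  also have "\<dots> = B * (B + 1) ^ D" by (simp only: B_def power_mult_distrib)
  also have "\<dots> < (B + 1) ^ Suc D" by simp
  also have "\<dots> = card A" unfolding A_def by (simp add: card_PiE)
  finally have "\<not> inj_on f A" by (rule pigeonhole)
  then obtain c d where cd: "c \<in> A" "d \<in> A" "c \<noteq> d" "f c = f d" by (auto simp: inj_on_def)
  show thesis
  proof (rule that[of "\<lambda>k. int (c k) - int (d k)"])
    have "\<exists>k\<in>{..D}. c k \<noteq> d k"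
      using cd(1-3) unfolding A_def by (meson PiE_ext)
    then show "\<exists>k\<le>D. int (c k) - int (d k) \<noteq> 0" by auto
    show "\<bar>int (c k) - int (d k)\<bar> \<le> int ((2 * (D + 1) * G) ^ D)" if "k \<le> D" for k
    proof -
      have "c k \<le> B" "d k \<le> B" using cd(1,2) that unfolding A_def by (auto simp: PiE_def Pi_def)
      then have "\<bar>int (c k) - int (d k)\<bar> \<le> int B" by linarith
      then show ?thesis by (simp only: B_def)
    qed
    show "(\<Sum>k\<le>D. (int (c k) - int (d k)) * q k i) = 0" if "i \<in> I" for i
      using fun_cong[OF cd(4), of i] that
      by (simp add: f_def left_diff_distrib sum_subtractf)
  qed
qed

text \<open>
  A substitute for the absolute values of all conjugates of \<open>x\<close>: the size of the coefficients in some
  representation of \<open>x\<close> as an integer combination of the generators \<open>b\<close>. The generators need not be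
  independent, so the representation need not be unique, and the predicate only bounds it from above.
\<close>

definition height_le :: "'i set \<Rightarrow> ('i \<Rightarrow> complex) \<Rightarrow> complex \<Rightarrow> real \<Rightarrow> bool" where
  "height_le I b x H \<longleftrightarrow>
     (\<exists>z :: 'i \<Rightarrow> int. x = (\<Sum>i\<in>I. of_int (z i) * b i) \<and> (\<Sum>i\<in>I. \<bar>real_of_int (z i)\<bar>) \<le> H)"

lemma height_le_mono: "height_le I b x H \<Longrightarrow> H \<le> H' \<Longrightarrow> height_le I b x H'"
  unfolding height_le_def by (blast intro: order_trans)

lemma height_le_zero: "0 \<le> H \<Longrightarrow> height_le I b 0 H"
  unfolding height_le_def by (intro exI[of _ "\<lambda>_. 0"]) simp

lemma height_le_add:
  assumes "height_le I b x H" "height_le I b y H'"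
  shows "height_le I b (x + y) (H + H')"
proof -
  obtain z w where "x = (\<Sum>i\<in>I. of_int (z i) * b i)" "(\<Sum>i\<in>I. \<bar>real_of_int (z i)\<bar>) \<le> H"
    "y = (\<Sum>i\<in>I. of_int (w i) * b i)" "(\<Sum>i\<in>I. \<bar>real_of_int (w i)\<bar>) \<le> H'"
    using assms unfolding height_le_def by blast
  moreover have "(\<Sum>i\<in>I. \<bar>real_of_int (z i + w i)\<bar>)
      \<le> (\<Sum>i\<in>I. \<bar>real_of_int (z i)\<bar>) + (\<Sum>i\<in>I. \<bar>real_of_int (w i)\<bar>)"
    unfolding sum.distrib[symmetric] by (intro sum_mono) simp
  ultimately show ?thesis unfolding height_le_def
    by (intro exI[of _ "\<lambda>i. z i + w i"]) (auto simp: algebra_simps sum.distrib)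
qed

lemma height_le_of_int_mult:
  assumes "height_le I b x H" "\<bar>real_of_int k\<bar> \<le> K" "0 \<le> H"
  shows "height_le I b (of_int k * x) (K * H)"
proof -
  obtain z where z: "x = (\<Sum>i\<in>I. of_int (z i) * b i)" "(\<Sum>i\<in>I. \<bar>real_of_int (z i)\<bar>) \<le> H"
    using assms unfolding height_le_def by blast
  have "(\<Sum>i\<in>I. \<bar>real_of_int (k * z i)\<bar>) = \<bar>real_of_int k\<bar> * (\<Sum>i\<in>I. \<bar>real_of_int (z i)\<bar>)"
    by (simp add: abs_mult sum_distrib_left)
  also have "\<dots> \<le> K * H"
    using assms z by (intro mult_mono) (auto intro: sum_nonneg order_trans)
  finally show ?thesis unfolding height_le_def z(1)
    by (intro exI[of _ "\<lambda>i. k * z i"]) (auto simp: algebra_simps sum_distrib_left)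
qed

lemma height_le_sum:
  assumes "\<And>s. s \<in> S \<Longrightarrow> height_le I b (f s) (h s)"
  shows "height_le I b (\<Sum>s\<in>S. f s) (\<Sum>s\<in>S. h s)"
  using assms
  by (induction S rule: infinite_finite_induct) (auto intro: height_le_zero height_le_add)

lemma height_le_basis:
  assumes "finite I" "i \<in> I"
  shows "height_le I b (b i) 1"
  unfolding height_le_def
  using assms by (intro exI[of _ "\<lambda>k. if k = i then 1 else 0"])
    (simp add: if_distrib[of of_int] if_distrib[of abs] if_distrib[of "\<lambda>x. x * _"] sum.delta cong: if_cong)

lemma height_le_mult_linear:
  assumes "\<And>i. i \<in> I \<Longrightarrow> height_le I b (y * b i) C" "height_le I b x H" "0 \<le> C"
  shows "height_le I b (y * x) (C * H)"
proof -
  obtain z where z: "x = (\<Sum>i\<in>I. of_int (z i) * b i)" "(\<Sum>i\<in>I. \<bar>real_of_int (z i)\<bar>) \<le> H"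
    using assms unfolding height_le_def by blast
  have "height_le I b (\<Sum>i\<in>I. of_int (z i) * (y * b i)) (\<Sum>i\<in>I. \<bar>real_of_int (z i)\<bar> * C)"
    by (intro height_le_sum height_le_of_int_mult assms) auto
  moreover have "(\<Sum>i\<in>I. of_int (z i) * (y * b i)) = y * x"
    unfolding z(1) by (simp add: sum_distrib_left algebra_simps)
  moreover have "(\<Sum>i\<in>I. \<bar>real_of_int (z i)\<bar> * C) \<le> C * H"
    using mult_left_mono[OF z(2) assms(3)] by (simp add: sum_distrib_left mult.commute)
  ultimately show ?thesis by (metis height_le_mono)
qed

text \<open>
  The generators \<open>b\<close> span a subring of the complex numbers that is a finitely generated abelian group.
  The single constant \<open>C\<close> makes the height submultiplicative up to a factor.
\<close>

locale int_ring_basis =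
  fixes I :: "'i set" and b :: "'i \<Rightarrow> complex" and C :: real
  assumes fin: "finite I" and C_ge_1: "C \<ge> 1"
    and height_one: "height_le I b 1 C"
    and height_basis_mult: "\<And>i j. i \<in> I \<Longrightarrow> j \<in> I \<Longrightarrow> height_le I b (b i * b j) C"
begin

lemma height_mult:
  assumes "height_le I b x H" "height_le I b y H'" "0 \<le> H" "0 \<le> H'"
  shows "height_le I b (x * y) (C * H * H')"
proof (rule height_le_mult_linear)
  show "height_le I b (x * b i) (C * H)" if "i \<in> I" for i
    using height_le_mult_linear[of I b "b i" C x H] height_basis_mult that assms C_ge_1
    by (simp add: mult.commute)
qed (use assms C_ge_1 in auto)

lemma height_power:
  assumes "height_le I b x H" "0 \<le> H"
  shows "height_le I b (x ^ k) (C * (C * H) ^ k)"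
proof (induction k)
  case 0
  then show ?case using height_one by simp
next
  case (Suc k)
  have "height_le I b (x * x ^ k) (C * H * (C * (C * H) ^ k))"
    using C_ge_1 assms Suc by (intro height_mult) auto
  then show ?case by (simp add: algebra_simps)
qed

text \<open>
  The powers \<open>1, x, \<dots>, x ^ D\<close> are \<open>D + 1\<close> integer vectors in \<open>D\<close> coordinates, so Siegel's lemma gives an
  integer relation between them. What matters is that its coefficients are polynomial in the height
  of \<open>x\<close>, with an exponent that depends on the ring alone.
\<close>

lemma small_integer_relation:
  obtains K E where "K > 0"
    "\<And>x H. 1 \<le> H \<Longrightarrow> height_le I b x H \<Longrightarrow>
       \<exists>c :: nat \<Rightarrow> int. (\<exists>k\<le>card I. c k \<noteq> 0) \<and> (\<forall>k\<le>card I. \<bar>real_of_int (c k)\<bar> \<le> K * H ^ E) \<and>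
         (\<Sum>k\<le>card I. of_int (c k) * x ^ k) = 0"
proof -
  define D where "D = card I"
  define K where "K = (2 * (real D + 1) * (2 * C * C ^ D)) ^ D"
  have "\<exists>c :: nat \<Rightarrow> int. (\<exists>k\<le>D. c k \<noteq> 0) \<and> (\<forall>k\<le>D. \<bar>real_of_int (c k)\<bar> \<le> K * H ^ (D * D)) \<and>
         (\<Sum>k\<le>D. of_int (c k) * x ^ k) = 0"
    if H: "1 \<le> H" and x: "height_le I b x H" for x H
  proof -
    define M where "M = C * (C * H) ^ D"
    define G where "G = nat \<lceil>M\<rceil>"
    have CH: "1 \<le> C * H" using H C_ge_1 mult_mono[of 1 C 1 H] by simp
    have M1: "1 \<le> M"
      unfolding M_def using mult_mono[of 1 C 1 "(C * H) ^ D"] C_ge_1 one_le_power[OF CH, of D] by simp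
    have G: "M \<le> real G" "real G \<le> 2 * M" "1 \<le> G"
      unfolding G_def using M1 by linarith+
    have "\<exists>z :: 'i \<Rightarrow> int. x ^ k = (\<Sum>i\<in>I. of_int (z i) * b i) \<and> (\<forall>i\<in>I. \<bar>z i\<bar> \<le> int G)"
      if k: "k \<le> D" for k
    proof -
      have "height_le I b (x ^ k) (C * (C * H) ^ k)"
        using height_power[OF x] H by simp
      moreover have "C * (C * H) ^ k \<le> M"
        unfolding M_def using C_ge_1 CH k by (intro mult_left_mono power_increasing) auto
      ultimately have "height_le I b (x ^ k) M" by (rule height_le_mono)
      then obtain z where z: "x ^ k = (\<Sum>i\<in>I. of_int (z i) * b i)"
        "(\<Sum>i\<in>I. \<bar>real_of_int (z i)\<bar>) \<le> M" unfolding height_le_def by blast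
      have "\<bar>z i\<bar> \<le> int G" if "i \<in> I" for i
      proof -
        have "\<bar>real_of_int (z i)\<bar> \<le> (\<Sum>i\<in>I. \<bar>real_of_int (z i)\<bar>)"
          using fin that by (intro member_le_sum) auto
        then have "\<bar>real_of_int (z i)\<bar> \<le> real G" using z G by linarith
        then show ?thesis by linarith
      qed
      with z show ?thesis by blast
    qed
    then obtain q :: "nat \<Rightarrow> 'i \<Rightarrow> int" where q: "\<And>k. k \<le> D \<Longrightarrow> x ^ k = (\<Sum>i\<in>I. of_int (q k i) * b i)"
      "\<And>k i. k \<le> D \<Longrightarrow> i \<in> I \<Longrightarrow> \<bar>q k i\<bar> \<le> int G" by metis
    obtain c where c: "\<exists>k\<le>D. c k \<noteq> 0" "\<And>k. k \<le> D \<Longrightarrow> \<bar>c k\<bar> \<le> int ((2 * (D + 1) * G) ^ D)"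
      "\<And>i. i \<in> I \<Longrightarrow> (\<Sum>k\<le>D. c k * q k i) = 0"
      using small_integer_kernel_vector[OF fin D_def G(3), of q] q(2) by blast
    have "(\<Sum>k\<le>D. of_int (c k) * x ^ k) = (\<Sum>k\<le>D. \<Sum>i\<in>I. of_int (c k * q k i) * b i)"
      using q(1) by (intro sum.cong) (auto simp: sum_distrib_left algebra_simps)
    also have "\<dots> = (\<Sum>i\<in>I. of_int (\<Sum>k\<le>D. c k * q k i) * b i)"
      by (subst sum.swap) (simp add: sum_distrib_right)
    also have "\<dots> = 0" using c(3) by simp
    finally have "(\<Sum>k\<le>D. of_int (c k) * x ^ k) = 0" .
    moreover have "\<bar>real_of_int (c k)\<bar> \<le> K * H ^ (D * D)" if "k \<le> D" for k
    proof -
      have "\<bar>real_of_int (c k)\<bar> \<le> real_of_int (int ((2 * (D + 1) * G) ^ D))"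
        using c(2)[OF that] by linarith
      also have "\<dots> = (2 * (real D + 1) * real G) ^ D" by (simp add: algebra_simps)
      also have "\<dots> \<le> (2 * (real D + 1) * (2 * M)) ^ D"
        using G by (intro power_mono mult_left_mono) auto
      also have "\<dots> = K * H ^ (D * D)"
        by (simp add: K_def M_def power_mult_distrib power_mult)
      finally show ?thesis .
    qed
    ultimately show ?thesis using c(1) by blast
  qed
  moreover have "K > 0" unfolding K_def using C_ge_1 by (intro zero_less_power) (simp add: zero_less_mult_iff)
  ultimately show thesis using that[of K "D * D"] unfolding D_def by blast
qed

lemma algebraic_of_height:
  assumes "height_le I b x H"
  shows "algebraic x"
proof -
  have "height_le I b x (max H 1)" using assms by (rule height_le_mono) simp
  moreover obtain K E where "K > 0" "\<And>x H. 1 \<le> H \<Longrightarrow> height_le I b x H \<Longrightarrow>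
       \<exists>c :: nat \<Rightarrow> int. (\<exists>k\<le>card I. c k \<noteq> 0) \<and> (\<forall>k\<le>card I. \<bar>real_of_int (c k)\<bar> \<le> K * H ^ E) \<and>
         (\<Sum>k\<le>card I. of_int (c k) * x ^ k) = 0"
    using small_integer_relation by blast
  ultimately obtain c :: "nat \<Rightarrow> int" and k where c: "k \<le> card I" "c k \<noteq> 0"
      "(\<Sum>k\<le>card I. of_int (c k) * x ^ k) = 0"
    by (metis max.cobounded2)
  define p :: "complex poly" where "p = (\<Sum>k\<le>card I. monom (of_int (c k)) k)"
  have coeff: "coeff p i = (if i \<le> card I then of_int (c i) else 0)" for i
    by (simp add: p_def coeff_sum)
  show ?thesis
  proof (rule algebraicI[of p])
    show "p \<noteq> 0" using coeff[of k] c by auto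
    show "poly p x = 0" using c(3) by (simp add: p_def poly_sum poly_monom)
  qed (simp add: coeff)
qed

text \<open>
  In an integer relation between the powers of \<open>x\<close>, factor out the lowest power that occurs. The
  remaining constant term is a nonzero integer, and it is a multiple of \<open>x\<close> with a controlled
  cofactor. Hence \<open>x\<close> cannot be too small.
\<close>

lemma liouville_inequality:
  obtains K E where "K > 0"
    "\<And>x H. 1 \<le> H \<Longrightarrow> height_le I b x H \<Longrightarrow> x \<noteq> 0 \<Longrightarrow> cmod x \<le> 1 \<Longrightarrow> 1 \<le> K * H ^ E * cmod x"
proof -
  define D where "D = card I"
  obtain K E where KE: "K > 0" "\<And>x H. 1 \<le> H \<Longrightarrow> height_le I b x H \<Longrightarrow>
       \<exists>c :: nat \<Rightarrow> int. (\<exists>k\<le>D. c k \<noteq> 0) \<and> (\<forall>k\<le>D. \<bar>real_of_int (c k)\<bar> \<le> K * H ^ E) \<and>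
         (\<Sum>k\<le>D. of_int (c k) * x ^ k) = 0"
    unfolding D_def using small_integer_relation by blast
  have "1 \<le> ((real D + 1) * K) * H ^ E * cmod x"
    if H: "1 \<le> H" and x: "height_le I b x H" "x \<noteq> 0" "cmod x \<le> 1" for x H
  proof -
    obtain c :: "nat \<Rightarrow> int" where c: "\<exists>k\<le>D. c k \<noteq> 0"
      "\<And>k. k \<le> D \<Longrightarrow> \<bar>real_of_int (c k)\<bar> \<le> K * H ^ E" "(\<Sum>k\<le>D. of_int (c k) * x ^ k) = 0"
      using KE(2)[OF H x(1)] by blast
    define l where "l = (LEAST k. k \<le> D \<and> c k \<noteq> 0)"
    have l: "l \<le> D" "c l \<noteq> 0" using LeastI_ex[OF c(1)] unfolding l_def by auto
    have less: "c k = 0" if "k < l" for k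
      using not_less_Least[of k "\<lambda>k. k \<le> D \<and> c k \<noteq> 0"] that l(1) unfolding l_def by auto
    have "0 = (\<Sum>k\<le>D. of_int (c k) * x ^ k)" using c(3) by simp
    also have "\<dots> = (\<Sum>k\<in>{l..D}. of_int (c k) * x ^ k)"
      using less by (intro sum.mono_neutral_right) auto
    also have "\<dots> = of_int (c l) * x ^ l + (\<Sum>k\<in>{Suc l..D}. of_int (c k) * x ^ k)"
      using l by (simp add: sum.atLeast_Suc_atMost)
    also have "(\<Sum>k\<in>{Suc l..D}. of_int (c k) * x ^ k)
        = x ^ l * (x * (\<Sum>k\<in>{Suc l..D}. of_int (c k) * x ^ (k - Suc l)))"
    proof -
      have "x ^ k = x ^ l * (x * x ^ (k - Suc l))" if "Suc l \<le> k" for k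
        using that by (metis add_Suc_right le_add_diff_inverse mult.assoc power_Suc power_add add_Suc)
      then show ?thesis unfolding sum_distrib_left by (intro sum.cong) (auto simp: algebra_simps)
    qed
    finally have "x ^ l * (of_int (c l) + x * (\<Sum>k\<in>{Suc l..D}. of_int (c k) * x ^ (k - Suc l))) = 0"
      by (simp add: algebra_simps)
    then have eq: "of_int (c l) = - (x * (\<Sum>k\<in>{Suc l..D}. of_int (c k) * x ^ (k - Suc l)))"
      using x(2) by (simp add: add_eq_0_iff2)
    have "1 \<le> \<bar>real_of_int (c l)\<bar>" using l(2) by linarith
    also have "\<dots> = cmod (of_int (c l))" by simp
    also have "\<dots> = cmod x * cmod (\<Sum>k\<in>{Suc l..D}. of_int (c k) * x ^ (k - Suc l))"
      by (simp only: eq norm_minus_cancel norm_mult)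
    also have "\<dots> \<le> cmod x * (\<Sum>k\<in>{Suc l..D}. K * H ^ E)"
    proof (intro mult_left_mono sum_norm_le)
      fix k assume "k \<in> {Suc l..D}"
      then have "\<bar>real_of_int (c k)\<bar> * cmod x ^ (k - Suc l) \<le> (K * H ^ E) * 1"
        using c(2)[of k] x(3) by (intro mult_mono power_le_one) auto
      then show "cmod (of_int (c k) * x ^ (k - Suc l)) \<le> K * H ^ E"
        by (simp add: norm_mult norm_power)
    qed simp
    also have "\<dots> \<le> cmod x * ((real D + 1) * (K * H ^ E))"
      using KE(1) H by (auto intro!: mult_left_mono mult_right_mono)
    finally show ?thesis by (simp add: algebra_simps)
  qed
  then show thesis using KE(1) that[of "(real D + 1) * K" E] by auto
qed

end

section \<open>Rings generated by two algebraic numbers\<close>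

text \<open>
  Multiplying \<open>p(x) = 0\<close> by \<open>l ^ (d - 1)\<close>, where \<open>l\<close> is the leading coefficient, gives a monic equation
  for \<open>l x\<close>. The sign of \<open>l\<close> is moved to the other coefficients so that the multiplier is a natural number.
\<close>

lemma algebraic_imp_int_multiple_integral:
  fixes x :: complex
  assumes "algebraic x"
  obtains k d :: nat and c :: "nat \<Rightarrow> int" where "k > 0" "d > 0"
    "(of_nat k * x) ^ d = (\<Sum>i<d. of_int (c i) * (of_nat k * x) ^ i)"
proof -
  obtain p where p: "\<And>i. coeff p i \<in> \<int>" "p \<noteq> 0" "poly p x = 0"
    using assms by (rule algebraicE) blast
  have "\<exists>z. coeff p i = of_int z" for i using p(1)[of i] by (auto elim: Ints_cases)
  then obtain q where q: "\<And>i. coeff p i = of_int (q i)" by metis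
  define d where "d = degree p"
  have d: "d > 0"
  proof (rule ccontr)
    assume "\<not> d > 0"
    then obtain e where "p = [:e:]" unfolding d_def by (metis degree_eq_zeroE gr0I)
    with p show False by auto
  qed
  have lead: "q d \<noteq> 0" using p(2) q[of d] unfolding d_def by auto
  define l where "l = \<bar>q d\<bar>"
  define y where "y = of_int l * x"
  have sgn: "of_int (sgn (q d)) * of_int (q d) = (of_int l :: complex)"
    unfolding l_def by (simp flip: of_int_mult add: abs_sgn[symmetric] mult.commute)
  have "0 = of_int (sgn (q d)) * of_int l ^ (d - 1) * (\<Sum>i\<le>d. coeff p i * x ^ i)"
    using p(3) by (simp add: poly_altdef d_def)
  also have "(\<Sum>i\<le>d. coeff p i * x ^ i) = of_int (q d) * x ^ d + (\<Sum>i<d. of_int (q i) * x ^ i)"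
    by (simp add: q flip: lessThan_Suc_atMost)
  also have "of_int (sgn (q d)) * of_int l ^ (d - 1) * \<dots>
      = of_int l * of_int l ^ (d - 1) * x ^ d
        + (\<Sum>i<d. of_int (sgn (q d)) * of_int l ^ (d - 1) * (of_int (q i) * x ^ i))"
    unfolding sgn[symmetric] distrib_left sum_distrib_left by (simp add: mult_ac)
  also have "of_int l * of_int l ^ (d - 1) * x ^ d = y ^ d"
    using d by (cases d) (simp_all add: y_def power_mult_distrib)
  also have "(\<Sum>i<d. of_int (sgn (q d)) * of_int l ^ (d - 1) * (of_int (q i) * x ^ i))
      = (\<Sum>i<d. of_int (sgn (q d) * l ^ (d - 1 - i) * q i) * y ^ i)"
  proof (intro sum.cong refl)
    fix i assume "i \<in> {..<d}"
    then have "d - 1 = (d - 1 - i) + i" by simp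
    then have "(of_int l :: complex) ^ (d - 1) = of_int l ^ (d - 1 - i) * of_int l ^ i"
      by (metis power_add)
    then show "of_int (sgn (q d)) * of_int l ^ (d - 1) * (of_int (q i) * x ^ i)
        = of_int (sgn (q d) * l ^ (d - 1 - i) * q i) * y ^ i"
      by (simp add: y_def power_mult_distrib algebra_simps)
  qed
  finally have "y ^ d = - (\<Sum>i<d. of_int (sgn (q d) * l ^ (d - 1 - i) * q i) * y ^ i)"
    by (simp add: add_eq_0_iff2)
  also have "\<dots> = (\<Sum>i<d. of_int (- (sgn (q d) * l ^ (d - 1 - i) * q i)) * y ^ i)"
    by (simp add: sum_negf)
  finally have "y ^ d = (\<Sum>i<d. of_int (- (sgn (q d) * l ^ (d - 1 - i) * q i)) * y ^ i)" .
  moreover have "y = of_nat (nat l) * x" unfolding y_def l_def by simp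
  moreover have "nat l > 0" unfolding l_def using lead by simp
  ultimately show thesis using that d by metis
qed

lemma height_le_power_mult:
  assumes "\<And>i. i \<in> I \<Longrightarrow> height_le I b (y * b i) A" "height_le I b x H" "0 \<le> A"
  shows "height_le I b (y ^ k * x) (A ^ k * H)"
proof (induction k)
  case (Suc k)
  have "height_le I b (y * (y ^ k * x)) (A * (A ^ k * H))"
    using height_le_mult_linear[OF assms(1) Suc assms(3)] by simp
  then show ?case by (simp add: mult.assoc)
qed (use assms in simp)

text \<open>
  For algebraic integers \<open>a\<close> and \<open>v\<close> the monomials \<open>a ^ i * v ^ j\<close> below the degrees of their monic equations
  generate the ring of all integer polynomials in \<open>a\<close> and \<open>v\<close>: multiplication by \<open>a\<close> or \<open>v\<close> either moves
  to the next monomial or is reduced by the equation.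
\<close>

lemma monomial_int_ring_basis:
  fixes a v :: complex and c c' :: "nat \<Rightarrow> int"
  assumes "d > 0" "e > 0"
    and a: "a ^ d = (\<Sum>i<d. of_int (c i) * a ^ i)"
    and v: "v ^ e = (\<Sum>i<e. of_int (c' i) * v ^ i)"
  obtains C where "int_ring_basis ({..<d} \<times> {..<e}) (\<lambda>(i, j). a ^ i * v ^ j) C"
    "height_le ({..<d} \<times> {..<e}) (\<lambda>(i, j). a ^ i * v ^ j) a C"
    "height_le ({..<d} \<times> {..<e}) (\<lambda>(i, j). a ^ i * v ^ j) v C"
proof -
  define I where "I = {..<d} \<times> {..<e}"
  define b where "b = (\<lambda>(i, j). a ^ i * v ^ j)"
  define A where "A = 1 + (\<Sum>i<d. \<bar>real_of_int (c i)\<bar>)"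
  define V where "V = 1 + (\<Sum>i<e. \<bar>real_of_int (c' i)\<bar>)"
  have AV: "1 \<le> A" "1 \<le> V" unfolding A_def V_def by (simp_all add: sum_nonneg)
  have fin: "finite I" by (simp add: I_def)
  have basis: "height_le I b (a ^ i * v ^ j) 1" if "i < d" "j < e" for i j
    using height_le_basis[OF fin, of "(i, j)" b] that by (simp add: I_def b_def)
  have ha: "height_le I b (a * b k) A" if k: "k \<in> I" for k
  proof -
    obtain i j where ij: "k = (i, j)" "i < d" "j < e" using k by (auto simp: I_def)
    show ?thesis
    proof (cases "Suc i < d")
      case True
      then show ?thesis using basis[of "Suc i" j] ij AV by (auto simp: b_def algebra_simps intro: height_le_mono)
    next
      case False
      then have "Suc i = d" using ij by simp
      then have "a * b k = a ^ d * v ^ j" by (auto simp: ij b_def)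
      also have "\<dots> = (\<Sum>i<d. of_int (c i) * (a ^ i * v ^ j))"
        by (subst a) (simp add: sum_distrib_right mult.assoc)
      finally have "a * b k = (\<Sum>i<d. of_int (c i) * (a ^ i * v ^ j))" .
      moreover have "height_le I b (\<Sum>i<d. of_int (c i) * (a ^ i * v ^ j)) (\<Sum>i<d. \<bar>real_of_int (c i)\<bar> * 1)"
        using ij basis by (intro height_le_sum height_le_of_int_mult) auto
      ultimately show ?thesis unfolding A_def by (auto intro: height_le_mono)
    qed
  qed
  have hv: "height_le I b (v * b k) V" if k: "k \<in> I" for k
  proof -
    obtain i j where ij: "k = (i, j)" "i < d" "j < e" using k by (auto simp: I_def)
    show ?thesis
    proof (cases "Suc j < e")
      case True
      then show ?thesis using basis[of i "Suc j"] ij AV by (auto simp: b_def algebra_simps intro: height_le_mono)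
    next
      case False
      then have "Suc j = e" using ij by simp
      then have "v * b k = a ^ i * v ^ e" by (auto simp: ij b_def)
      also have "\<dots> = (\<Sum>j<e. of_int (c' j) * (a ^ i * v ^ j))"
        by (subst v) (simp add: sum_distrib_left mult.left_commute)
      finally have "v * b k = (\<Sum>j<e. of_int (c' j) * (a ^ i * v ^ j))" .
      moreover have "height_le I b (\<Sum>j<e. of_int (c' j) * (a ^ i * v ^ j)) (\<Sum>j<e. \<bar>real_of_int (c' j)\<bar> * 1)"
        using ij basis by (intro height_le_sum height_le_of_int_mult) auto
      ultimately show ?thesis unfolding V_def by (auto intro: height_le_mono)
    qed
  qed
  define C where "C = A ^ d * V ^ e"
  have one: "1 \<le> A ^ d" "1 \<le> V ^ e" using AV by (simp_all add: one_le_power)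
  have AC: "A \<le> C" "V \<le> C" "1 \<le> C"
  proof -
    have "A \<le> A ^ d" "V \<le> V ^ e" using AV assms(1,2) by (simp_all add: self_le_power)
    then show "A \<le> C" "V \<le> C" "1 \<le> C" unfolding C_def
      using mult_mono[of A "A ^ d" 1 "V ^ e"] mult_mono[of 1 "A ^ d" V "V ^ e"]
        mult_mono[of 1 "A ^ d" 1 "V ^ e"] one AV by auto
  qed
  have "int_ring_basis I b C"
  proof
    show "height_le I b 1 C"
      using basis[of 0 0] assms(1,2) AC by (auto intro: height_le_mono)
    show "height_le I b (b k * b l) C" if kl: "k \<in> I" "l \<in> I" for k l
    proof -
      obtain i j where ij: "k = (i, j)" "i < d" "j < e" using kl by (auto simp: I_def)
      have "height_le I b (v ^ j * b l) (V ^ j * 1)"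
        using AV(2) by (intro height_le_power_mult[OF hv height_le_basis[OF fin kl(2)]]) auto
      then have "height_le I b (a ^ i * (v ^ j * b l)) (A ^ i * (V ^ j * 1))"
        using AV(1) by (intro height_le_power_mult[OF ha]) auto
      moreover have "A ^ i * (V ^ j * 1) \<le> C" unfolding C_def using ij AV
        by (auto intro!: mult_mono power_increasing)
      ultimately show ?thesis by (auto simp: ij b_def algebra_simps intro: height_le_mono)
    qed
  qed (use fin AC in auto)
  moreover have "height_le I b a C"
    using ha[of "(0, 0)"] assms(1,2) AC by (auto simp: I_def b_def intro: height_le_mono)
  moreover have "height_le I b v C"
    using hv[of "(0, 0)"] assms(1,2) AC by (auto simp: I_def b_def intro: height_le_mono)
  ultimately show thesis using that unfolding I_def b_def by blast
qed

lemma algebraic_pair_height: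
  fixes a v :: complex
  assumes "algebraic a" "algebraic v"
  obtains k l :: nat and I :: "(nat \<times> nat) set" and b C where "k > 0" "l > 0" "int_ring_basis I b C"
    "height_le I b (of_nat k * a) C" "height_le I b (of_nat l * v) C"
proof -
  obtain k d :: nat and c :: "nat \<Rightarrow> int" where 1: "k > 0" "d > 0"
    "(of_nat k * a) ^ d = (\<Sum>i<d. of_int (c i) * (of_nat k * a) ^ i)"
    using assms(1) by (rule algebraic_imp_int_multiple_integral)
  obtain l e :: nat and c' :: "nat \<Rightarrow> int" where 2: "l > 0" "e > 0"
    "(of_nat l * v) ^ e = (\<Sum>i<e. of_int (c' i) * (of_nat l * v) ^ i)"
    using assms(2) by (rule algebraic_imp_int_multiple_integral)
  show thesis
    using monomial_int_ring_basis[OF 1(2) 2(2) 1(3) 2(3)] 1(1) 2(1) that by metis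
qed

lemma algebraic_of_nat_mult_cancel:
  fixes x :: "'a :: field_char_0"
  assumes "algebraic (of_nat k * x)" "k > 0"
  shows "algebraic x"
proof -
  obtain p where p: "\<And>i. coeff p i \<in> \<int>" "p \<noteq> 0" "poly p (of_nat k * x) = 0"
    using assms(1) by (rule algebraicE) blast
  show ?thesis
  proof (rule algebraicI)
    show "coeff (pcompose p [:0, of_nat k:]) i \<in> \<int>" for i
      using p by (intro allI coeff_pcompose_semiring_closed) (auto simp: coeff_pCons split: nat.splits)
    show "pcompose p [:0, of_nat k:] \<noteq> 0" using p assms by (auto simp: pcompose_eq_0_iff)
    show "poly (pcompose p [:0, of_nat k:]) x = 0" using p by (simp add: poly_pcompose mult.commute)
  qed
qed

text \<open>
  Sum and product, after clearing denominators, lie in the ring generated by two algebraic integers,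
  and all elements of that ring are algebraic.
\<close>

lemma algebraic_complex_add_mult:
  fixes x y :: complex
  assumes "algebraic x" "algebraic y"
  shows "algebraic (x + y)" "algebraic (x * y)"
proof -
  obtain k l :: nat and I :: "(nat \<times> nat) set" and b C where kl: "k > 0" "l > 0" and "int_ring_basis I b C"
    and h: "height_le I b (of_nat k * x) C" "height_le I b (of_nat l * y) C"
    using algebraic_pair_height[OF assms] by metis
  interpret int_ring_basis I b C by fact
  have "height_le I b (of_int (int l) * (of_nat k * x) + of_int (int k) * (of_nat l * y)) (real l * C + real k * C)"
    using h C_ge_1 by (intro height_le_add height_le_of_int_mult) auto
  then have "algebraic (of_int (int l) * (of_nat k * x) + of_int (int k) * (of_nat l * y))"
    by (rule algebraic_of_height)
  also have "of_int (int l) * (of_nat k * x) + of_int (int k) * (of_nat l * y) = of_nat (k * l) * (x + y)"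
    by (simp add: algebra_simps)
  finally have "algebraic (of_nat (k * l) * (x + y))" .
  then show "algebraic (x + y)" by (rule algebraic_of_nat_mult_cancel) (use kl in simp)
  have "height_le I b ((of_nat k * x) * (of_nat l * y)) (C * C * C)"
    using h C_ge_1 by (intro height_mult) auto
  then have "algebraic ((of_nat k * x) * (of_nat l * y))"
    by (rule algebraic_of_height)
  also have "(of_nat k * x) * (of_nat l * y) = of_nat (k * l) * (x * y)"
    by (simp add: algebra_simps)
  finally have "algebraic (of_nat (k * l) * (x * y))" .
  then show "algebraic (x * y)" by (rule algebraic_of_nat_mult_cancel) (use kl in simp)
qed

lemma algebraic_real_add: "algebraic x \<Longrightarrow> algebraic y \<Longrightarrow> algebraic (x + y :: real)"
  using algebraic_complex_add_mult(1)[of "of_real x" "of_real y"] by (simp flip: of_real_add)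

lemma algebraic_real_mult: "algebraic x \<Longrightarrow> algebraic y \<Longrightarrow> algebraic (x * y :: real)"
  using algebraic_complex_add_mult(2)[of "of_real x" "of_real y"] by (simp flip: of_real_mult)

text \<open>
  The cosine is half the sum of a root of unity and its conjugate.
\<close>

lemma algebraic_cos_rational_angle:
  assumes "r \<in> \<rat>"
  shows "algebraic (cos (r * pi))"
proof -
  obtain p q where q: "q > 0" and r: "r = of_int p / of_int q" using assms by (rule Rats_cases')
  define z where "z = cis (r * pi)"
  have "z ^ nat (2 * q) = cis (real (nat (2 * q)) * (r * pi))"
    unfolding z_def by (rule Complex.DeMoivre)
  also have "real (nat (2 * q)) * (r * pi) = 2 * pi * of_int p"
    using q by (simp add: r)
  also have "cis \<dots> = 1" by (rule cis_multiple_2pi) simp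
  finally have zq: "z ^ nat (2 * q) = 1" .
  have "algebraic z"
  proof (rule algebraic_root[of 1])
    show "poly (monom 1 (nat (2 * q))) z = 1" using zq by (simp add: poly_monom)
  qed (use q in \<open>auto simp: degree_monom_eq rat_imp_algebraic\<close>)
  then have "algebraic (z + cnj z)" by (intro algebraic_complex_add_mult) auto
  then have "algebraic (of_nat 2 * complex_of_real (cos (r * pi)))"
    by (simp add: complex_add_cnj z_def)
  then have "algebraic (complex_of_real (cos (r * pi)))" by (rule algebraic_of_nat_mult_cancel) simp
  then show ?thesis by simp
qed

section \<open>Hermite's integrals\<close>

definition node_poly :: "nat \<Rightarrow> complex poly" where
  "node_poly m = (\<Prod>i\<le>m. [:- of_nat i, 1:])"

lemma poly_node_poly: "poly (node_poly m) z = (\<Prod>i\<le>m. z - of_nat i)"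
  by (simp add: node_poly_def poly_prod)

lemma lead_coeff_node_poly: "lead_coeff (node_poly m) = 1"
  unfolding node_poly_def by (simp add: lead_coeff_prod)

lemma degree_node_poly: "degree (node_poly m) = Suc m"
  unfolding node_poly_def by (subst degree_prod_eq_sum_degree) auto

lemma norm_node_poly_ge:
  assumes "cmod z = real (Suc N + m)"
  shows "real (Suc N) ^ Suc m \<le> cmod (poly (node_poly m) z)"
proof -
  have "(\<Prod>i\<le>m. real (Suc N)) \<le> (\<Prod>i\<le>m. cmod (z - of_nat i))"
  proof (intro prod_mono conjI)
    fix i assume "i \<in> {..m}"
    moreover have "cmod z - cmod (of_nat i) \<le> cmod (z - of_nat i)" by (rule norm_triangle_ineq2)
    ultimately show "real (Suc N) \<le> cmod (z - of_nat i)" using assms by simp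
  qed simp
  then show ?thesis by (simp add: poly_node_poly prod_norm)
qed

lemma node_poly_nonzero: "cmod z = real (Suc N + m) \<Longrightarrow> poly (node_poly m) z \<noteq> 0"
  using norm_node_poly_ge[of z N m] by (smt (verit) norm_zero zero_less_power of_nat_0_less_iff zero_less_Suc)

text \<open>
  The residue of \<open>Q(z) exp(a z) / ((z - 0) \<dots> (z - m)) ^ (N + 1)\<close> at the node \<open>j\<close> is \<open>exp(a j)\<close> times a
  polynomial in \<open>a\<close>, so the sum of the residues is a linear form in \<open>1, exp a, \<dots>, exp (m a)\<close>. These are
  the Hermite-Pade approximants of the first kind to the powers of the exponential function, written
  as contour integrals. The exponent is \<open>Suc N\<close> so that residues are coefficients with index \<open>N\<close>.
\<close>

definition exp_quotient :: "complex \<Rightarrow> nat \<Rightarrow> nat \<Rightarrow> complex poly \<Rightarrow> complex \<Rightarrow> complex" where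
  "exp_quotient a m N Q z = poly Q z * exp (a * z) / poly (node_poly m) z ^ Suc N"

text \<open>
  The radius grows with \<open>N\<close>: on this circle all nodes are at distance at least \<open>Suc N\<close>, which makes
  the integrand small, while all poles lie inside.
\<close>

definition hermite_integral :: "complex \<Rightarrow> nat \<Rightarrow> nat \<Rightarrow> complex poly \<Rightarrow> complex" where
  "hermite_integral a m N Q =
     contour_integral (circlepath 0 (real (Suc N + m))) (exp_quotient a m N Q) / (2 * pi * \<i>)"

lemma exp_quotient_integrable:
  "exp_quotient a m N Q contour_integrable_on circlepath 0 (real (Suc N + m))"
  unfolding exp_quotient_def
  by (intro contour_integrable_continuous_circlepath continuous_intros)
    (auto simp: node_poly_nonzero simp del: of_nat_add of_nat_Suc)

lemma hermite_integral_add: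
  "hermite_integral a m N (P + Q) = hermite_integral a m N P + hermite_integral a m N Q"
proof -
  have "exp_quotient a m N (P + Q) = (\<lambda>z. exp_quotient a m N P z + exp_quotient a m N Q z)"
    by (simp add: exp_quotient_def fun_eq_iff distrib_right add_divide_distrib)
  then show ?thesis unfolding hermite_integral_def
    using contour_integral_add[OF exp_quotient_integrable[of a m N P] exp_quotient_integrable[of a m N Q]]
    by (simp add: add_divide_distrib)
qed

lemma hermite_integral_smult:
  "hermite_integral a m N (smult c Q) = c * hermite_integral a m N Q"
proof -
  have "exp_quotient a m N (smult c Q) = (\<lambda>z. c * exp_quotient a m N Q z)"
    by (simp add: exp_quotient_def fun_eq_iff)
  then show ?thesis unfolding hermite_integral_def
    using contour_integral_lmul[OF exp_quotient_integrable[of a m N Q], of c] by simp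
qed

text \<open>
  The integrand is the derivative of \<open>S(z) exp(a z) / W(z) ^ N\<close>, where \<open>W\<close> is the node polynomial, and
  the contour is closed.
\<close>

lemma hermite_integral_by_parts:
  "hermite_integral a m N ((pderiv S + smult a S) * node_poly m - smult (of_nat N) (S * pderiv (node_poly m))) = 0"
    (is "hermite_integral a m N ?R = 0")
proof -
  let ?W = "node_poly m" and ?\<gamma> = "circlepath 0 (real (Suc N + m))"
  let ?f = "\<lambda>z. poly S z * exp (a * z) / poly ?W z ^ N"
  have "(?f has_field_derivative exp_quotient a m N ?R z) (at z within path_image ?\<gamma>)"
    if z: "z \<in> path_image ?\<gamma>" for z
  proof -
    have nz: "poly ?W z \<noteq> 0" using z node_poly_nonzero[of z N m] by auto
    have "(?f has_field_derivative ((poly (pderiv S) z * exp (a * z) + poly S z * (a * exp (a * z))) * poly ?W z ^ N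
        - poly S z * exp (a * z) * (of_nat N * poly ?W z ^ (N - 1) * poly (pderiv ?W) z))
        / (poly ?W z ^ N * poly ?W z ^ N)) (at z within path_image ?\<gamma>)"
      using nz by (auto intro!: derivative_eq_intros simp: algebra_simps)
    moreover have "((poly (pderiv S) z * exp (a * z) + poly S z * (a * exp (a * z))) * poly ?W z ^ N
        - poly S z * exp (a * z) * (of_nat N * poly ?W z ^ (N - 1) * poly (pderiv ?W) z))
        / (poly ?W z ^ N * poly ?W z ^ N) = exp_quotient a m N ?R z"
      using nz unfolding exp_quotient_def by (cases N) (simp_all add: field_simps)
    ultimately show ?thesis by simp
  qed
  then have "(exp_quotient a m N ?R has_contour_integral ?f (pathfinish ?\<gamma>) - ?f (pathstart ?\<gamma>)) ?\<gamma>"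
    by (rule contour_integral_primitive) auto
  then show ?thesis unfolding hermite_integral_def by (simp add: contour_integral_unique)
qed

text \<open>
  This numerator cancels all poles except a simple one at \<open>0\<close>.
\<close>

lemma hermite_integral_simple_pole:
  "hermite_integral a m N ((\<Prod>i\<in>{1..m}. [:- of_nat i, 1:]) * node_poly m ^ N) = 1"
    (is "hermite_integral a m N ?Q = 1")
proof -
  let ?r = "real (Suc N + m)"
  have "contour_integral (circlepath 0 ?r) (exp_quotient a m N ?Q)
      = contour_integral (circlepath 0 ?r) (\<lambda>z. exp (a * z) / (z - 0))"
  proof (rule contour_integral_eq)
    fix z assume "z \<in> path_image (circlepath 0 ?r)"
    then have z: "cmod z = ?r" by auto
    have nz: "poly (node_poly m) z \<noteq> 0" by (rule node_poly_nonzero[OF z])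
    have "{..m} = insert 0 {1..m}" by auto
    then have W: "poly (node_poly m) z = z * poly (\<Prod>i\<in>{1..m}. [:- of_nat i, 1:]) z"
      by (simp add: poly_node_poly poly_prod)
    show "exp_quotient a m N ?Q z = exp (a * z) / (z - 0)"
      using nz unfolding exp_quotient_def by (auto simp: W field_simps)
  qed
  moreover have "((\<lambda>z. exp (a * z) / (z - 0)) has_contour_integral 2 * of_real pi * \<i> * exp (a * 0)) (circlepath 0 ?r)"
    by (rule Cauchy_integral_circlepath_simple) (auto intro!: holomorphic_intros)
  then have "contour_integral (circlepath 0 ?r) (\<lambda>z. exp (a * z) / (z - 0)) = 2 * of_real pi * \<i> * exp (a * 0)"
    by (rule contour_integral_unique)
  ultimately show ?thesis unfolding hermite_integral_def by simp
qed

text \<open>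
  If the integral vanished on \<open>1, z, \<dots>, z ^ m\<close>, it would vanish on all polynomials: integration by parts
  gives, in each degree above \<open>m\<close>, a polynomial with zero integral and nonzero leading coefficient (a
  multiple of \<open>a\<close>), and this allows the degree to be reduced. But the integral is not
  identically zero.
\<close>

lemma hermite_integral_nonvanishing:
  assumes "a \<noteq> 0"
  obtains r where "r \<le> m" "hermite_integral a m N (monom 1 r) \<noteq> 0"
proof -
  have False if van: "\<And>r. r \<le> m \<Longrightarrow> hermite_integral a m N (monom 1 r) = 0"
  proof -
    have red: "hermite_integral a m N Q = hermite_integral a m N (Q - P)"
      if "hermite_integral a m N P = 0" for P Q
      using hermite_integral_add[of a m N "Q - P" P] that by simp
    have "\<forall>Q. (\<forall>i\<ge>k. coeff Q i = 0) \<longrightarrow> hermite_integral a m N Q = 0" for k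
    proof (induction k)
      case 0
      have "Q = 0" if "\<forall>i\<ge>0. coeff Q i = 0" for Q :: "complex poly"
        using that by (simp add: poly_eq_iff)
      then show ?case using hermite_integral_smult[of a m N 0 0] by auto
    next
      case (Suc k)
      show ?case
      proof (intro allI impI)
        fix Q :: "complex poly" assume Q: "\<forall>i\<ge>Suc k. coeff Q i = 0"
        define c where "c = coeff Q k"
        (* A polynomial with zero integral and the same leading term as Q: the monomial itself in
           low degree, and otherwise integration by parts with S chosen so that a S W has that leading term. *)
        define P where "P = (if k \<le> m then smult c (monom 1 k)
          else (let S = monom (c / a) (k - Suc m) in (pderiv S + smult a S) * node_poly m
             - smult (of_nat N) (S * pderiv (node_poly m))))"
        have "hermite_integral a m N P = 0"
          using van[of k] hermite_integral_by_parts
          unfolding P_def by (simp add: hermite_integral_smult Let_def del: smult_monom)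
        moreover have "coeff P i = (if i = k then c else 0)" if i: "i \<ge> k" for i
        proof (cases "k \<le> m")
          case True
          then show ?thesis by (simp add: P_def)
        next
          case False
          define s where "s = k - Suc m"
          have k: "k = Suc m + s" using False by (simp add: s_def)
          have top: "coeff (node_poly m) (Suc m) = 1"
            using lead_coeff_node_poly[of m] by (simp add: degree_node_poly)
          have high: "coeff (node_poly m) j = 0" if "j > Suc m" for j
            using that by (intro coeff_eq_0) (simp add: degree_node_poly)
          have 1: "coeff (monom (c / a) s * pderiv (node_poly m)) i = 0"
            using i k by (simp add: coeff_monom_mult coeff_pderiv high)
          have 2: "coeff (pderiv (monom (c / a) s) * node_poly m) i = 0"
            using i k by (cases s) (simp_all add: pderiv_monom coeff_monom_mult high)
          have 3: "coeff (smult a (monom (c / a) s) * node_poly m) i = (if i = k then c else 0)"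
            using i k assms top by (auto simp: coeff_monom_mult smult_monom high)
          show ?thesis using False 1 2 3 unfolding P_def Let_def s_def[symmetric]
            by (simp add: distrib_right del: mult_smult_left smult_monom)
        qed
        then have "\<forall>i\<ge>k. coeff (Q - P) i = 0"
          using Q by (auto simp: c_def Suc_le_eq)
        ultimately show "hermite_integral a m N Q = 0"
          using Suc red[of P Q] by simp
      qed
    qed
    moreover have "\<exists>k. \<forall>i\<ge>k. coeff Q i = 0" for Q :: "complex poly"
      by (intro exI[of _ "Suc (degree Q)"]) (auto intro: coeff_eq_0 simp: Suc_le_eq)
    ultimately have "hermite_integral a m N Q = 0" for Q by blast
    then show False using hermite_integral_simple_pole[of a m N] by simp
  qed
  then show thesis using that by blast
qed

lemma norm_hermite_integral_monom_le:
  assumes "r \<le> m"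
  shows "cmod (hermite_integral a m N (monom 1 r))
      \<le> real (Suc N + m) ^ Suc m * exp (cmod a * real (Suc N + m)) / real (Suc N) ^ (Suc m * Suc N)"
proof -
  define \<rho> where "\<rho> = real (Suc N + m)"
  define B where "B = \<rho> ^ m * exp (cmod a * \<rho>) / real (Suc N) ^ (Suc m * Suc N)"
  have \<rho>: "\<rho> \<ge> 1" unfolding \<rho>_def by simp
  have "cmod (contour_integral (circlepath 0 \<rho>) (exp_quotient a m N (monom 1 r))) \<le> B * (2 * pi * \<rho>)"
  proof (rule has_contour_integral_bound_circlepath)
    show "(exp_quotient a m N (monom 1 r) has_contour_integral
        contour_integral (circlepath 0 \<rho>) (exp_quotient a m N (monom 1 r))) (circlepath 0 \<rho>)"
      unfolding \<rho>_def using exp_quotient_integrable by (rule has_contour_integral_integral)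
    show "0 \<le> B" "0 < \<rho>" unfolding B_def using \<rho> by auto
    fix z assume "cmod (z - 0) = \<rho>"
    then have z: "cmod z = \<rho>" by simp
    have "cmod z ^ r * cmod (exp (a * z)) \<le> \<rho> ^ m * exp (cmod a * \<rho>)"
    proof (intro mult_mono)
      show "cmod z ^ r \<le> \<rho> ^ m" using z \<rho> assms by (simp add: power_increasing)
      have "cmod (exp (a * z)) \<le> exp (cmod (a * z))" by (rule norm_exp)
      then show "cmod (exp (a * z)) \<le> exp (cmod a * \<rho>)" by (simp add: norm_mult z)
    qed (use \<rho> in auto)
    moreover have "(real (Suc N) ^ Suc m) ^ Suc N \<le> cmod (poly (node_poly m) z) ^ Suc N"
      using norm_node_poly_ge[of z N m] z unfolding \<rho>_def by (intro power_mono) auto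
    moreover have "0 < (real (Suc N) ^ Suc m) ^ Suc N" by simp
    ultimately have "cmod z ^ r * cmod (exp (a * z)) / cmod (poly (node_poly m) z) ^ Suc N
        \<le> \<rho> ^ m * exp (cmod a * \<rho>) / (real (Suc N) ^ Suc m) ^ Suc N"
      using \<rho> by (intro frac_le) auto
    then show "cmod (exp_quotient a m N (monom 1 r) z) \<le> B"
      unfolding B_def exp_quotient_def power_mult
      by (simp add: norm_mult norm_divide norm_power poly_monom del: power_Suc)
  qed
  then have "cmod (hermite_integral a m N (monom 1 r)) \<le> B * (2 * pi * \<rho>) / (2 * pi)"
    unfolding hermite_integral_def \<rho>_def[symmetric] by (simp add: norm_divide norm_mult field_simps)
  then show ?thesis unfolding B_def \<rho>_def[symmetric] by (simp add: mult_ac)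
qed

text \<open>
  The Taylor series at the node \<open>j\<close> of \<open>z ^ r / (\<Prod>i\<noteq>j. z - i) ^ (N + 1)\<close>, that is, the part of the integrand
  that does not involve the exponential function or the pole.
\<close>

definition local_fps :: "nat \<Rightarrow> nat \<Rightarrow> nat \<Rightarrow> nat \<Rightarrow> complex fps" where
  "local_fps m N j r = (fps_const (of_nat j) + fps_X) ^ r *
     (\<Prod>i\<in>{..m} - {j}. inverse (fps_const (of_int (int j - int i)) + fps_X) ^ Suc N)"

lemma residue_exp_quotient:
  assumes "j \<le> m"
  shows "residue (exp_quotient a m N (monom 1 r)) (of_nat j)
      = exp a ^ j * fps_nth (local_fps m N j r * fps_exp a) N"
proof -
  define h where "h = (\<lambda>x. exp a ^ j * ((of_nat j + x) ^ r *
     (\<Prod>i\<in>{..m} - {j}. inverse (of_int (int j - int i) + x) ^ Suc N) * exp (a * x)))"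
  have "h has_fps_expansion fps_const (exp a ^ j) * (local_fps m N j r * fps_exp a)"
    unfolding h_def local_fps_def by (intro fps_expansion_intros) auto
  then have "residue (\<lambda>x. h x / x ^ Suc N) 0 = exp a ^ j * fps_nth (local_fps m N j r * fps_exp a) N"
    by (subst residue_fps_expansion_over_power_at_0) auto
  moreover have "(\<lambda>x. exp_quotient a m N (monom 1 r) (of_nat j + x)) = (\<lambda>x. h x / x ^ Suc N)"
  proof
    fix x :: complex
    have "poly (node_poly m) (of_nat j + x) = x * (\<Prod>i\<in>{..m} - {j}. of_int (int j - int i) + x)"
      using assms unfolding poly_node_poly by (subst prod.remove[of _ j]) (auto simp: algebra_simps)
    moreover have "exp (a * (of_nat j + x)) = exp a ^ j * exp (a * x)"
      by (simp add: distrib_left exp_add exp_of_nat_mult mult.commute[of a "of_nat j"])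
    moreover have "(\<Prod>i\<in>{..m} - {j}. inverse (of_int (int j - int i) + x) ^ Suc N)
        = inverse ((\<Prod>i\<in>{..m} - {j}. of_int (int j - int i) + x) ^ Suc N)"
      unfolding prod_power_distrib[symmetric] by (simp only: prod_inversef[unfolded o_def] power_inverse)
    ultimately show "exp_quotient a m N (monom 1 r) (of_nat j + x) = h x / x ^ Suc N"
      unfolding exp_quotient_def h_def poly_monom power_mult_distrib
      by (simp add: divide_inverse mult_ac power_mult_distrib del: power_Suc)
  qed
  ultimately show ?thesis by (subst residue_shift_0) simp
qed

lemma hermite_integral_eq_sum_residues:
  "hermite_integral a m N (monom 1 r)
     = (\<Sum>j\<le>m. exp a ^ j * fps_nth (local_fps m N j r * fps_exp a) N)"
proof -
  let ?f = "exp_quotient a m N (monom 1 r)" and ?r = "real (Suc N + m)"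
  let ?P = "of_nat ` {..m} :: complex set"
  have "contour_integral (circlepath 0 ?r) ?f
      = 2 * pi * \<i> * (\<Sum>p\<in>?P. winding_number (circlepath 0 ?r) p * residue ?f p)"
  proof (rule Residue_theorem[of UNIV])
    show "?f holomorphic_on UNIV - ?P"
      unfolding exp_quotient_def
      by (intro holomorphic_intros) (auto simp: poly_node_poly)
    show "path_image (circlepath 0 ?r) \<subseteq> UNIV - ?P"
      using node_poly_nonzero[of _ N m] by (auto simp: poly_node_poly)
  qed auto
  also have "(\<Sum>p\<in>?P. winding_number (circlepath 0 ?r) p * residue ?f p) = (\<Sum>p\<in>?P. residue ?f p)"
    by (intro sum.cong refl) (auto simp: winding_number_circlepath)
  also have "\<dots> = (\<Sum>j\<le>m. residue ?f (of_nat j))"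
    by (subst sum.reindex) (auto simp: inj_on_def)
  also have "\<dots> = (\<Sum>j\<le>m. exp a ^ j * fps_nth (local_fps m N j r * fps_exp a) N)"
    by (intro sum.cong refl residue_exp_quotient) auto
  finally show ?thesis unfolding hermite_integral_def by simp
qed

text \<open>
  Simultaneous control of the denominators and the sizes of the coefficients, in a form that is
  stable under multiplication by \<open>1 / (d + X)\<close>: the size bound only doubles, and one more power of
  \<open>\<delta>\<close> clears the denominators if \<open>d\<close> divides \<open>\<delta>\<close>.
\<close>

definition tame_fps :: "nat \<Rightarrow> nat \<Rightarrow> real \<Rightarrow> complex fps \<Rightarrow> bool" where
  "tame_fps \<delta> e A F \<longleftrightarrow>
     (\<forall>k. of_nat \<delta> ^ (e + k) * fps_nth F k \<in> \<int> \<and> cmod (fps_nth F k) \<le> A * 2 ^ k)"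

lemma tame_fps_mult_linear:
  assumes "tame_fps \<delta> e A F"
  shows "tame_fps \<delta> e ((real j + 1) * A) ((fps_const (of_nat j) + fps_X) * F)"
  unfolding tame_fps_def
proof (intro allI conjI)
  fix k
  have F: "of_nat \<delta> ^ (e + k) * fps_nth F k \<in> \<int>" "cmod (fps_nth F k) \<le> A * 2 ^ k" for k
    using assms unfolding tame_fps_def by auto
  have A: "A \<ge> 0" using F(2)[of 0] by (simp add: order_trans[OF norm_ge_zero])
  show "of_nat \<delta> ^ (e + k) * fps_nth ((fps_const (of_nat j) + fps_X) * F) k \<in> \<int>"
  proof (cases k)
    case 0
    then show ?thesis using F(1)[of 0] by (auto simp: distrib_right mult.left_commute)
  next
    case (Suc l)
    have "of_nat \<delta> ^ (e + k) * fps_nth ((fps_const (of_nat j) + fps_X) * F) k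
       = of_nat j * (of_nat \<delta> ^ (e + k) * fps_nth F k) + of_nat \<delta> * (of_nat \<delta> ^ (e + l) * fps_nth F l)"
      by (simp add: Suc distrib_right algebra_simps)
    then show ?thesis using F(1)[of k] F(1)[of l] by auto
  qed
  show "cmod (fps_nth ((fps_const (of_nat j) + fps_X) * F) k) \<le> (real j + 1) * A * 2 ^ k"
  proof (cases k)
    case 0
    then show ?thesis using F(2)[of 0] A mult_left_mono[OF F(2)[of 0], of "real j"]
      by (simp add: distrib_right norm_mult)
  next
    case (Suc l)
    have "cmod (fps_nth ((fps_const (of_nat j) + fps_X) * F) k)
       = cmod (of_nat j * fps_nth F k + fps_nth F l)" by (simp add: Suc distrib_right)
    also have "\<dots> \<le> real j * cmod (fps_nth F k) + cmod (fps_nth F l)"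
      by (rule order_trans[OF norm_triangle_ineq]) (simp add: norm_mult)
    also have "\<dots> \<le> real j * (A * 2 ^ k) + A * 2 ^ l"
      by (intro add_mono mult_left_mono F) auto
    also have "\<dots> \<le> real j * (A * 2 ^ k) + A * 2 ^ k"
      using A by (simp add: Suc mult_left_mono)
    finally show ?thesis by (simp add: algebra_simps)
  qed
qed

text \<open>
  The product \<open>G\<close> satisfies \<open>d G\<^sub>k + G\<^sub>k\<^sub>-\<^sub>1 = F\<^sub>k\<close>, and both properties follow from this recursion.
\<close>

lemma tame_fps_mult_inverse_linear:
  assumes "tame_fps \<delta> e A F" and d: "d \<noteq> 0" "d dvd int \<delta>"
  shows "tame_fps \<delta> (Suc e) (2 * A) (inverse (fps_const (of_int d) + fps_X) * F)"
proof -
  let ?L = "fps_const (of_int d) + fps_X :: complex fps"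
  define G where "G = inverse ?L * F"
  have "?L * inverse ?L = 1" using d by (subst mult.commute, intro inverse_mult_eq_1) simp
  then have "?L * G = F" by (simp add: G_def flip: mult.assoc)
  then have nth: "fps_nth F k = of_int d * fps_nth G k + (if k = 0 then 0 else fps_nth G (k - 1))" for k
    by (auto simp: distrib_right)
  obtain q where q: "int \<delta> = d * q" using d(2) by (auto simp: dvd_def)
  then have \<delta>: "(of_nat \<delta> :: complex) = of_int d * of_int q"
    by (metis of_int_mult of_int_of_nat_eq)
  have F: "of_nat \<delta> ^ (e + k) * fps_nth F k \<in> \<int>" "cmod (fps_nth F k) \<le> A * 2 ^ k" for k
    using assms(1) unfolding tame_fps_def by auto
  have d1: "1 \<le> cmod (of_int d)" using d(1) by simp
  have "of_nat \<delta> ^ (Suc e + k) * fps_nth G k \<in> \<int> \<and> cmod (fps_nth G k) \<le> 2 * A * 2 ^ k" for k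
  proof (induction k)
    case 0
    have A: "A \<ge> 0" using F(2)[of 0] by (simp add: order_trans[OF norm_ge_zero])
    have "of_nat \<delta> ^ (Suc e + 0) * fps_nth G 0 = of_int q * (of_nat \<delta> ^ (e + 0) * fps_nth F 0)"
      by (simp add: nth \<delta>)
    also have "\<dots> \<in> \<int>" by (rule Ints_mult[OF Ints_of_int F(1)])
    finally have "of_nat \<delta> ^ (Suc e + 0) * fps_nth G 0 \<in> \<int>" .
    moreover have "cmod (fps_nth G 0) \<le> 2 * A"
      using F(2)[of 0] A mult_right_mono[OF d1, of "cmod (fps_nth G 0)"] by (simp add: nth norm_mult)
    ultimately show ?case by simp
  next
    case (Suc k)
    have e: "of_int d * fps_nth G (Suc k) = fps_nth F (Suc k) - fps_nth G k"
      by (simp add: nth)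
    have "of_nat \<delta> ^ (Suc e + Suc k) * fps_nth G (Suc k)
        = of_int q * of_nat \<delta> ^ (e + Suc k) * (of_int d * fps_nth G (Suc k))"
      by (simp add: \<delta>)
    also have "\<dots> = of_int q * (of_nat \<delta> ^ (e + Suc k) * fps_nth F (Suc k)
        - of_nat \<delta> ^ (Suc e + k) * fps_nth G k)"
      unfolding e by (simp add: algebra_simps)
    also have "\<dots> \<in> \<int>" by (intro Ints_mult[OF Ints_of_int] Ints_diff F conjunct1[OF Suc])
    finally have "of_nat \<delta> ^ (Suc e + Suc k) * fps_nth G (Suc k) \<in> \<int>" .
    moreover have "cmod (fps_nth G (Suc k)) \<le> cmod (of_int d) * cmod (fps_nth G (Suc k))"
      using mult_right_mono[OF d1, of "cmod (fps_nth G (Suc k))"] by simp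
    moreover have "cmod (of_int d) * cmod (fps_nth G (Suc k)) \<le> A * 2 ^ Suc k + 2 * A * 2 ^ k"
      unfolding norm_mult[symmetric] e
      using norm_triangle_ineq4[of "fps_nth F (Suc k)" "fps_nth G k"] F(2)[of "Suc k"] Suc by linarith
    ultimately show ?case by simp
  qed
  then show ?thesis unfolding tame_fps_def G_def by blast
qed

lemma tame_fps_mult_inverse_linear_power:
  assumes "tame_fps \<delta> e A F" and d: "d \<noteq> 0" "d dvd int \<delta>"
  shows "tame_fps \<delta> (e + n) (2 ^ n * A) (inverse (fps_const (of_int d) + fps_X) ^ n * F)"
proof (induction n)
  case (Suc n)
  show ?case using tame_fps_mult_inverse_linear[OF Suc d] by (simp add: mult_ac)
qed (use assms in simp)

text \<open>
  The differences of nodes are at most \<open>m\<close> in absolute value, so they divide \<open>fact m\<close>.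
\<close>

lemma tame_local_fps:
  assumes "j \<le> m"
  shows "tame_fps (fact m) (m * Suc N) ((real j + 1) ^ r * 2 ^ (m * Suc N)) (local_fps m N j r)"
proof -
  have "tame_fps (fact m) (card S * Suc N) (2 ^ (card S * Suc N))
     (\<Prod>i\<in>S. inverse (fps_const (of_int (int j - int i)) + fps_X) ^ Suc N)" if "S \<subseteq> {..m} - {j}" for S
    using finite_subset[OF that finite_Diff[OF finite_atMost]] that
  proof (induction S rule: finite_induct)
    case empty
    show ?case by (auto simp: tame_fps_def)
  next
    case (insert i S)
    have "int j - int i \<noteq> 0" using insert by auto
    moreover have "int j - int i dvd int (fact m)"
    proof -
      have "nat \<bar>int j - int i\<bar> dvd fact m" using insert assms by (intro dvd_fact) auto
      then show ?thesis by (simp add: nat_abs_dvd_iff)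
    qed
    moreover have "tame_fps (fact m) (card S * Suc N) (2 ^ (card S * Suc N))
      (\<Prod>i\<in>S. inverse (fps_const (of_int (int j - int i)) + fps_X) ^ Suc N)"
      using insert by auto
    ultimately have "tame_fps (fact m) (card S * Suc N + Suc N) (2 ^ Suc N * 2 ^ (card S * Suc N))
      (inverse (fps_const (of_int (int j - int i)) + fps_X) ^ Suc N *
       (\<Prod>i\<in>S. inverse (fps_const (of_int (int j - int i)) + fps_X) ^ Suc N))"
      by (intro tame_fps_mult_inverse_linear_power)
    moreover have e: "card (insert i S) * Suc N = card S * Suc N + Suc N" using insert(1,2) by simp
    moreover have "(2::real) ^ (card (insert i S) * Suc N) = 2 ^ Suc N * 2 ^ (card S * Suc N)"
      unfolding e power_add by simp
    ultimately show ?case by (simp only: prod.insert[OF insert(1,2)])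
  qed
  from this[OF order_refl] have *: "tame_fps (fact m) (m * Suc N) (2 ^ (m * Suc N))
     (\<Prod>i\<in>{..m} - {j}. inverse (fps_const (of_int (int j - int i)) + fps_X) ^ Suc N)"
    using assms by simp
  have "tame_fps (fact m) (m * Suc N) ((real j + 1) ^ s * 2 ^ (m * Suc N))
     ((fps_const (of_nat j) + fps_X) ^ s *
     (\<Prod>i\<in>{..m} - {j}. inverse (fps_const (of_int (int j - int i)) + fps_X) ^ Suc N))" for s
  proof (induction s)
    case (Suc s)
    show ?case using tame_fps_mult_linear[OF Suc, of j] by (simp add: mult_ac)
  qed (use * in simp)
  then show ?thesis unfolding local_fps_def .
qed

section \<open>The Hermite-Lindemann theorem\<close>

context int_ring_basis
begin

text \<open>
  By the residue theorem the scaled integral is an integer combination of monomials in the ring elements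
  \<open>k a\<close> and \<open>l exp a\<close>. The scaling factor clears, in this order, the denominators of \<open>exp a\<close> and \<open>a\<close>, the factorials
  in the exponential series, and the denominators of the Taylor coefficients at the nodes. Only
  \<open>fact N\<close> grows faster than exponentially in \<open>N\<close>; the powers of \<open>Suc N\<close> in the smallness estimate
  have to compete with it.
\<close>

lemma scaled_hermite_integral_height:
  fixes a :: complex and k l m :: nat
  assumes kl: "k > 0" "l > 0" and ha: "height_le I b (of_nat k * a) C"
    and hv: "height_le I b (of_nat l * exp a) C"
  obtains K where "K \<ge> 1" "\<And>N r. r \<le> m \<Longrightarrow> height_le I b
     (of_nat l ^ m * of_nat k ^ N * fact N * fact m ^ (m * Suc N + N) * hermite_integral a m N (monom 1 r))
     (fact N * K ^ Suc N)"
proof -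
  define \<delta> :: nat where "\<delta> = fact m"
  have \<delta>1: "1 \<le> \<delta>" by (simp add: \<delta>_def fact_ge_1)
  define K0 where "K0 = real l ^ m * (real m + 1) ^ Suc m * (C ^ 3 * (C * C) ^ m)"
  define X where "X = real k * real \<delta> * real \<delta> * 2 * (C * C)"
  define Y where "Y = (real \<delta> * 2) ^ m"
  define K where "K = 2 * X * Y * K0"
  have CC: "1 \<le> C * C" using C_ge_1 mult_mono[of 1 C 1 C] by simp
  have prod1: "1 \<le> u * v" if "1 \<le> u" "1 \<le> v" for u v :: real using mult_mono[of 1 u 1 v] that by simp
  have ge1: "1 \<le> K0" "1 \<le> X" "1 \<le> Y"
    unfolding K0_def X_def Y_def using kl \<delta>1 C_ge_1 CC by (auto intro!: prod1 one_le_power simp del: power_Suc)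
  have K1: "1 \<le> K" unfolding K_def using ge1 by (intro prod1) auto
  have "height_le I b
     (of_nat l ^ m * of_nat k ^ N * fact N * fact m ^ (m * Suc N + N) * hermite_integral a m N (monom 1 r))
     (fact N * K ^ Suc N)" if r: "r \<le> m" for N r
  proof -
    define e where "e = m * Suc N"
    define F where "F j = local_fps m N j r" for j
    define Z where "Z = real \<delta> ^ (e + N) * (real m + 1) ^ m * 2 ^ (e + N)"
    have "\<exists>z :: int. of_nat \<delta> ^ (e + i) * fps_nth (F j) i = of_int z \<and> \<bar>real_of_int z\<bar> \<le> Z"
      if j: "j \<le> m" and i: "i \<le> N" for j i
    proof -
      have tame: "tame_fps \<delta> e ((real j + 1) ^ r * 2 ^ e) (F j)"
        using tame_local_fps[OF j] by (simp add: \<delta>_def e_def F_def)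
      then obtain z where z: "of_nat \<delta> ^ (e + i) * fps_nth (F j) i = of_int z"
        unfolding tame_fps_def by (metis Ints_cases)
      have "\<bar>real_of_int z\<bar> = cmod (of_nat \<delta> ^ (e + i) * fps_nth (F j) i)" by (simp add: z)
      also have "\<dots> = real \<delta> ^ (e + i) * cmod (fps_nth (F j) i)" by (simp add: norm_mult norm_power)
      also have "\<dots> \<le> real \<delta> ^ (e + i) * ((real j + 1) ^ r * 2 ^ e * 2 ^ i)"
        using tame unfolding tame_fps_def by (intro mult_left_mono) auto
      also have "\<dots> \<le> real \<delta> ^ (e + N) * ((real m + 1) ^ m * 2 ^ e * 2 ^ N)"
      proof (intro mult_mono)
        show "(real j + 1) ^ r \<le> (real m + 1) ^ m"
          using j r power_mono[of "real j + 1" "real m + 1" r] power_increasing[of r m "real m + 1"] by simp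
      qed (use i \<delta>1 in \<open>auto intro: power_increasing\<close>)
      finally show ?thesis using z by (auto simp: Z_def power_add algebra_simps)
    qed
    then obtain z :: "nat \<Rightarrow> nat \<Rightarrow> int" where z:
      "\<And>j i. j \<le> m \<Longrightarrow> i \<le> N \<Longrightarrow> of_nat \<delta> ^ (e + i) * fps_nth (F j) i = of_int (z j i)"
      "\<And>j i. j \<le> m \<Longrightarrow> i \<le> N \<Longrightarrow> \<bar>real_of_int (z j i)\<bar> \<le> Z" by metis
    define t where "t j i = of_nat l ^ m * of_nat k ^ N * fact N * fact m ^ (e + N) *
        (exp a ^ j * (fps_nth (F j) i * (a ^ (N - i) / fact (N - i))))" for j i
    define Q where "Q = real l ^ m * real k ^ N * fact N * real \<delta> ^ N * Z"
    define M where "M = C ^ 3 * (C * C) ^ (N + m)"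
    have M0: "0 \<le> M" unfolding M_def using C_ge_1 by simp
    have monomial: "height_le I b (t j i) (Q * M)" if j: "j \<le> m" and i: "i \<le> N" for j i
    proof -
      define c :: int where "c = int l ^ (m - j) * int k ^ i * int (fact N div fact (N - i)) * int \<delta> ^ (N - i) * z j i"
      have fd: "(of_nat (fact N div fact (N - i)) :: complex) = fact N / fact (N - i)"
      proof -
        have "fact (N - i) dvd (fact N :: nat)" by (rule fact_dvd) simp
        then obtain q :: nat where q: "fact N = fact (N - i) * q" by (rule dvdE)
        then have "(fact N :: complex) = fact (N - i) * of_nat q" by (metis of_nat_fact of_nat_mult)
        then show ?thesis by (simp add: q)
      qed
      (* Each scaling power is split into the part that this monomial absorbs and an integer factor. *)
      have pw: "(of_nat l :: complex) ^ m = of_nat l ^ (m - j) * of_nat l ^ j"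
        "(of_nat k :: complex) ^ N = of_nat k ^ i * of_nat k ^ (N - i)"
        "(of_nat \<delta> :: complex) ^ (e + N) = of_nat \<delta> ^ (N - i) * of_nat \<delta> ^ (e + i)"
        using i j by (simp_all add: add.commute flip: power_add)
      have "t j i = of_int c * ((of_nat k * a) ^ (N - i) * (of_nat l * exp a) ^ j)"
      proof -
        have "(fact m :: complex) = of_nat \<delta>" by (simp add: \<delta>_def)
        then have "t j i = of_nat l ^ (m - j) * of_nat k ^ i * (fact N / fact (N - i)) * of_nat \<delta> ^ (N - i)
            * (of_nat \<delta> ^ (e + i) * fps_nth (F j) i) * ((of_nat k * a) ^ (N - i) * (of_nat l * exp a) ^ j)"
          unfolding t_def by (simp only: pw) (simp add: power_mult_distrib mult_ac)
        then show ?thesis unfolding z(1)[OF j i] c_def by (simp add: fd mult_ac)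
      qed
      moreover have "\<bar>real_of_int c\<bar> \<le> Q"
      proof -
        have "real (fact N div fact (N - i)) \<le> fact N"
          by (metis div_le_dividend of_nat_fact of_nat_le_iff)
        moreover have "real l ^ (m - j) \<le> real l ^ m" "real k ^ i \<le> real k ^ N" "real \<delta> ^ (N - i) \<le> real \<delta> ^ N"
          using kl \<delta>1 i by (auto intro!: power_increasing)
        ultimately show ?thesis unfolding c_def Q_def using z(2)[OF j i]
          by (auto simp: abs_mult intro!: mult_mono)
      qed
      moreover have "height_le I b ((of_nat k * a) ^ (N - i) * (of_nat l * exp a) ^ j) M"
      proof (rule height_le_mono[OF height_mult[OF height_power[OF ha] height_power[OF hv]]])
        have "C * (C * (C * C) ^ (N - i)) * (C * (C * C) ^ j) = C ^ 3 * (C * C) ^ (N - i + j)"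
          by (simp add: power_add power3_eq_cube mult_ac)
        also have "\<dots> \<le> M" unfolding M_def using C_ge_1 CC i j
          by (intro mult_left_mono power_increasing) auto
        finally show "C * (C * (C * C) ^ (N - i)) * (C * (C * C) ^ j) \<le> M" .
      qed (use C_ge_1 in auto)
      ultimately show ?thesis using height_le_of_int_mult M0 by metis
    qed
    have "of_nat l ^ m * of_nat k ^ N * fact N * fact m ^ (m * Suc N + N) * hermite_integral a m N (monom 1 r)
        = (\<Sum>j\<le>m. \<Sum>i\<in>{0..N}. t j i)"
      unfolding hermite_integral_eq_sum_residues t_def fps_mult_nth F_def e_def
      by (simp add: sum_distrib_left)
    moreover have "height_le I b (\<Sum>j\<le>m. \<Sum>i\<in>{0..N}. t j i) (\<Sum>j\<le>m. \<Sum>i\<in>{0..N}. Q * M)"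
      using monomial by (intro height_le_sum) auto
    moreover have "(\<Sum>j\<le>m. \<Sum>i\<in>{0..N}. Q * M) \<le> fact N * K ^ Suc N"
    proof -
      have n: "real N + 1 \<le> 2 ^ Suc N" using of_nat_less_two_power[of "Suc N", where 'a = real] by simp
      have QM: "(real m + 1) * (Q * M) = fact N * (X ^ N * Y ^ Suc N * K0)"
        unfolding Q_def M_def Z_def X_def Y_def K0_def e_def
        by (simp add: power_mult_distrib power_add power_mult[symmetric] mult_ac)
      have "(\<Sum>j\<le>m. \<Sum>i\<in>{0..N}. Q * M) = (real N + 1) * ((real m + 1) * (Q * M))"
        by (simp add: algebra_simps)
      also have "\<dots> = fact N * ((real N + 1) * X ^ N * Y ^ Suc N * K0)"
        unfolding QM by (simp only: mult_ac)
      also have "\<dots> \<le> fact N * (2 ^ Suc N * X ^ Suc N * Y ^ Suc N * K0 ^ Suc N)"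
        using n ge1 by (intro mult_mono power_increasing self_le_power) auto
      also have "\<dots> = fact N * K ^ Suc N" unfolding K_def by (simp only: power_mult_distrib)
      finally show ?thesis .
    qed
    ultimately show ?thesis by (simp only: height_le_mono)
  qed
  with K1 show thesis using that by blast
qed

end

text \<open>
  The contour has radius \<open>N + 1 + m\<close>, so the numerator of the integrand and the scaling factor without
  \<open>fact N\<close> are at most exponential in \<open>N\<close>. Only the node polynomial in the denominator contributes powers of \<open>Suc N\<close>.
\<close>

lemma scaled_hermite_integral_small:
  fixes a :: complex and k l m :: nat
  assumes kl: "k > 0" "l > 0"
  obtains K where "K \<ge> 1" "\<And>N r. r \<le> m \<Longrightarrow> cmod
     (of_nat l ^ m * of_nat k ^ N * fact N * fact m ^ (m * Suc N + N) * hermite_integral a m N (monom 1 r))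
     \<le> fact N * K ^ Suc N / real (Suc N) ^ (Suc m * Suc N)"
proof -
  define \<delta> :: real where "\<delta> = fact m"
  have \<delta>1: "1 \<le> \<delta>" by (simp add: \<delta>_def fact_ge_1)
  define K0 where "K0 = real l ^ m * (real m + 1) ^ Suc m * exp (cmod a) ^ m"
  define X where "X = real k * \<delta>"
  define Y where "Y = \<delta> ^ m * 2 ^ Suc m * exp (cmod a)"
  define K where "K = K0 * X * Y"
  have prod1: "1 \<le> u * v" if "1 \<le> u" "1 \<le> v" for u v :: real using mult_mono[of 1 u 1 v] that by simp
  have ge1: "1 \<le> K0" "1 \<le> X" "1 \<le> Y"
    unfolding K0_def X_def Y_def using kl \<delta>1 by (auto intro!: prod1 one_le_power simp del: power_Suc)
  have K1: "1 \<le> K" unfolding K_def using ge1 by (intro prod1) auto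
  have "cmod (of_nat l ^ m * of_nat k ^ N * fact N * fact m ^ (m * Suc N + N) * hermite_integral a m N (monom 1 r))
     \<le> fact N * K ^ Suc N / real (Suc N) ^ (Suc m * Suc N)" if r: "r \<le> m" for N r
  proof -
    have n: "real N + 1 \<le> 2 ^ Suc N" using of_nat_less_two_power[of "Suc N", where 'a = real] by simp
    have "real (Suc N + m) \<le> (real m + 1) * (real N + 1)" by (simp add: algebra_simps)
    also have "\<dots> \<le> (real m + 1) * 2 ^ Suc N" using n by (intro mult_left_mono) auto
    finally have 1: "real (Suc N + m) ^ Suc m \<le> (real m + 1) ^ Suc m * (2 ^ Suc m) ^ Suc N"
      using power_mono[of "real (Suc N + m)" "(real m + 1) * 2 ^ Suc N" "Suc m"]
      by (simp only: power_mult_distrib power_mult[symmetric] mult.commute[of "Suc N"])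
    have 2: "exp (cmod a * real (Suc N + m)) = exp (cmod a) ^ m * exp (cmod a) ^ Suc N"
      unfolding power_add[symmetric] unfolding exp_of_nat_mult[symmetric] by (simp add: algebra_simps)
    let ?S = "real l ^ m * real k ^ N * fact N * \<delta> ^ (m * Suc N + N)"
    have "cmod (of_nat l ^ m * of_nat k ^ N * fact N * fact m ^ (m * Suc N + N) * hermite_integral a m N (monom 1 r))
       = ?S * cmod (hermite_integral a m N (monom 1 r))"
      unfolding \<delta>_def by (simp only: norm_mult norm_power norm_of_nat norm_fact)
    also have "\<dots> \<le> ?S * (((real m + 1) ^ Suc m * (2 ^ Suc m) ^ Suc N) * (exp (cmod a) ^ m * exp (cmod a) ^ Suc N)
        / real (Suc N) ^ (Suc m * Suc N))"
    proof (intro mult_left_mono)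
      show "cmod (hermite_integral a m N (monom 1 r)) \<le> ((real m + 1) ^ Suc m * (2 ^ Suc m) ^ Suc N) *
          (exp (cmod a) ^ m * exp (cmod a) ^ Suc N) / real (Suc N) ^ (Suc m * Suc N)"
        using norm_hermite_integral_monom_le[OF r, of a N] 1 unfolding 2
        by (elim order_trans) (intro divide_right_mono mult_right_mono, auto)
    qed (use \<delta>1 in auto)
    also have "\<dots> = fact N * (K0 * X ^ N * Y ^ Suc N) / real (Suc N) ^ (Suc m * Suc N)"
      unfolding K0_def X_def Y_def by (simp add: power_mult_distrib power_add power_mult[symmetric] mult_ac)
    also have "\<dots> \<le> fact N * (K0 ^ Suc N * X ^ Suc N * Y ^ Suc N) / real (Suc N) ^ (Suc m * Suc N)"
      using ge1 by (intro divide_right_mono mult_mono power_increasing self_le_power) auto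
    also have "\<dots> = fact N * K ^ Suc N / real (Suc N) ^ (Suc m * Suc N)"
      unfolding K_def by (simp only: power_mult_distrib)
    finally show ?thesis .
  qed
  with K1 show thesis using that by blast
qed

text \<open>
  For each \<open>N\<close>, one of the scaled integrals is a nonzero element of a fixed ring. With \<open>n = N + 1\<close> its height is at most
  \<open>(n K\<^sub>1) ^ n\<close> and its absolute value at most \<open>(K\<^sub>2 / n ^ m) ^ n\<close>. The exponent \<open>E\<close> of the Liouville inequality
  depends only on the ring and not on \<open>m\<close>, so \<open>m = E + 1\<close> is possible, and for large \<open>n\<close> the
  inequality fails.
\<close>

theorem hermite_lindemann:
  fixes a :: complex
  assumes "algebraic a" "a \<noteq> 0"
  shows "\<not> algebraic (exp a)"
proof
  assume "algebraic (exp a)"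
  then obtain k l :: nat and I :: "(nat \<times> nat) set" and b C where kl: "k > 0" "l > 0"
    and "int_ring_basis I b C"
    and h: "height_le I b (of_nat k * a) C" "height_le I b (of_nat l * exp a) C"
    using algebraic_pair_height[OF assms(1)] by metis
  interpret int_ring_basis I b C by fact
  obtain \<kappa> E where \<kappa>: "\<kappa> > 0" "\<And>x H. 1 \<le> H \<Longrightarrow> height_le I b x H \<Longrightarrow> x \<noteq> 0 \<Longrightarrow> cmod x \<le> 1
      \<Longrightarrow> 1 \<le> \<kappa> * H ^ E * cmod x"
    using liouville_inequality by blast
  define m where "m = Suc E"
  define y where "y N r = of_nat l ^ m * of_nat k ^ N * fact N * fact m ^ (m * Suc N + N)
    * hermite_integral a m N (monom 1 r)" for N r
  obtain K1 where K1: "K1 \<ge> 1" "\<And>N r. r \<le> m \<Longrightarrow> height_le I b (y N r) (fact N * K1 ^ Suc N)"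
    using scaled_hermite_integral_height[OF kl h, of m] unfolding y_def by blast
  obtain K2 where K2: "K2 \<ge> 1"
    "\<And>N r. r \<le> m \<Longrightarrow> cmod (y N r) \<le> fact N * K2 ^ Suc N / real (Suc N) ^ (Suc m * Suc N)"
    using scaled_hermite_integral_small[OF kl, where m = m and a = a] unfolding y_def by blast
  (* Large enough that K1 ^ E * K2 / n is at most 1/2 and that 2 ^ n exceeds the Liouville constant. *)
  define N where "N = nat \<lceil>2 * K1 ^ E * K2 + \<kappa>\<rceil>"
  define n where "n = real (Suc N)"
  have pos: "0 \<le> K1 ^ E * K2" using K1 K2 by simp
  have N: "2 * K1 ^ E * K2 + \<kappa> \<le> real N" unfolding N_def by (rule real_nat_ceiling_ge)
  have n1: "1 \<le> n" unfolding n_def by simp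
  have n: "2 * (K1 ^ E * K2) \<le> n" "\<kappa> < n" using N pos \<kappa>(1) unfolding n_def by auto
  obtain r where r: "r \<le> m" "hermite_integral a m N (monom 1 r) \<noteq> 0"
    using hermite_integral_nonvanishing[OF assms(2)] by blast
  define x where "x = y N r"
  have "x \<noteq> 0" unfolding x_def y_def using r kl by simp
  have fact_le: "fact N \<le> n ^ Suc N"
  proof -
    have "(fact N :: real) \<le> fact (Suc N)" by (rule fact_mono) simp
    also have "\<dots> \<le> n ^ Suc N" unfolding n_def by (metis fact_le_power of_nat_power)
    finally show ?thesis .
  qed
  have "cmod x \<le> fact N * K2 ^ Suc N / n ^ (Suc m * Suc N)"
    using K2(2)[OF r(1), of N] by (simp only: x_def n_def)
  also have "\<dots> \<le> n ^ Suc N * K2 ^ Suc N / n ^ (Suc m * Suc N)"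
    using fact_le n1 K2(1) by (intro divide_right_mono mult_right_mono) auto
  also have "\<dots> = (n * K2 / n ^ Suc m) ^ Suc N"
    by (simp only: power_mult power_mult_distrib power_divide)
  also have "n * K2 / n ^ Suc m = K2 / n ^ Suc E" using n1 by (simp add: m_def)
  finally have small: "cmod x \<le> (K2 / n ^ Suc E) ^ Suc N" .
  have "cmod x \<le> 1"
  proof -
    have "1 * K2 \<le> K1 ^ E * K2" using K1(1) K2(1) by (intro mult_right_mono one_le_power) auto
    then have "K2 \<le> n" using n(1) pos by linarith
    also have "n \<le> n ^ Suc E" using n1 by (intro self_le_power) auto
    finally have "K2 / n ^ Suc E \<le> 1" using n1 by (simp add: divide_le_eq)
    then have "(K2 / n ^ Suc E) ^ Suc N \<le> 1" using K2(1) n1 by (intro power_le_one) auto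
    with small show ?thesis by linarith
  qed
  have "height_le I b x ((n * K1) ^ Suc N)"
  proof (rule height_le_mono)
    show "height_le I b x (fact N * K1 ^ Suc N)" unfolding x_def by (rule K1(2)[OF r(1)])
    show "fact N * K1 ^ Suc N \<le> (n * K1) ^ Suc N"
      unfolding power_mult_distrib using fact_le K1(1) by (intro mult_right_mono) auto
  qed
  moreover have "1 \<le> (n * K1) ^ Suc N"
    using n1 K1(1) mult_mono[of 1 n 1 K1] by (intro one_le_power) auto
  ultimately have "1 \<le> \<kappa> * ((n * K1) ^ Suc N) ^ E * cmod x"
    using \<kappa>(2) \<open>x \<noteq> 0\<close> \<open>cmod x \<le> 1\<close> by blast
  also have "\<dots> \<le> \<kappa> * ((n * K1) ^ Suc N) ^ E * (K2 / n ^ Suc E) ^ Suc N"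
    using small \<kappa>(1) K1(1) n1 by (intro mult_left_mono) auto
  also have "\<dots> = \<kappa> * ((n * K1) ^ E * (K2 / n ^ Suc E)) ^ Suc N"
    by (simp only: power_mult_distrib power_mult[symmetric] mult.commute[of E] mult.assoc)
  also have "(n * K1) ^ E * (K2 / n ^ Suc E) = K1 ^ E * K2 / n"
    using n1 by (simp add: power_mult_distrib field_simps)
  also have "\<kappa> * (K1 ^ E * K2 / n) ^ Suc N \<le> \<kappa> * (1 / 2) ^ Suc N"
    using n n1 \<kappa>(1) pos by (intro mult_left_mono power_mono) (auto simp: field_simps)
  also have "\<dots> < 1"
  proof -
    have "\<kappa> < 2 ^ Suc N" using n(2) of_nat_less_two_power[of "Suc N", where 'a = real] unfolding n_def by linarith
    then show ?thesis by (simp add: power_divide)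
  qed
  finally show False by simp
qed

corollary hermite_lindemann_real:
  fixes x :: real
  assumes "algebraic x" "x \<noteq> 0"
  shows "\<not> algebraic (exp x)"
  using hermite_lindemann[of "of_real x"] assms by (simp add: exp_of_real)

section \<open>Hyperbolic trigonometry\<close>

lemma lorentz_commute: "lorentz x y = lorentz y x"
  by (simp add: lorentz_def mult.commute)

lemma lorentz_bilinear:
  "lorentz (x + y) z = lorentz x z + lorentz y z" "lorentz z (x + y) = lorentz z x + lorentz z y"
  "lorentz (x - y) z = lorentz x z - lorentz y z" "lorentz z (x - y) = lorentz z x - lorentz z y"
  "lorentz (c *\<^sub>R x) z = c * lorentz x z" "lorentz z (c *\<^sub>R x) = c * lorentz z x"
  by (simp_all add: lorentz_def algebra_simps)

lemma hyp_dist_commute: "hyp_dist p q = hyp_dist q p"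
  by (simp add: hyp_dist_def lorentz_commute)

lemma hyp_angle_commute: "hyp_angle A B C = hyp_angle C B A"
  by (simp add: hyp_angle_def lorentz_commute)

lemma hyp_direction_props:
  assumes "p \<in> hyp_plane" "q \<in> hyp_plane" "p \<noteq> q"
  shows "hyp_direction p q \<in> hyp_unit_tangent p"
    and "q = hyp_geodesic p (hyp_direction p q) (hyp_dist p q)"
    and "hyp_dist p q > 0"
proof -
  have dir: "hyp_direction p q \<in> hyp_unit_tangent p \<and> (\<exists>t>0. q = hyp_geodesic p (hyp_direction p q) t)"
    unfolding hyp_direction_def by (rule theI'[OF hyp_direction_unique[OF assms]])
  then obtain t where t: "t > 0" "q = hyp_geodesic p (hyp_direction p q) t" by blast
  moreover from dir have v: "hyp_direction p q \<in> hyp_unit_tangent p" ..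
  ultimately have "hyp_dist p q = t"
    using hyp_dist_geodesic[OF assms(1) v, of t] by simp
  then show "hyp_direction p q \<in> hyp_unit_tangent p"
    "q = hyp_geodesic p (hyp_direction p q) (hyp_dist p q)" "hyp_dist p q > 0"
    using t v by auto
qed

text \<open>
  The Cauchy-Schwarz inequality, from the positivity of the form on \<open>v + w\<close> and \<open>w - v\<close>.
\<close>

lemma lorentz_unit_tangents_bound:
  assumes p: "p \<in> hyp_plane" and v: "v \<in> hyp_unit_tangent p" and w: "w \<in> hyp_unit_tangent p"
  shows "\<bar>lorentz v w\<bar> \<le> 1" "\<bar>lorentz v w\<bar> = 1 \<Longrightarrow> w = v \<or> w = - v"
proof -
  have vw: "lorentz p v = 0" "lorentz v v = 1" "lorentz p w = 0" "lorentz w w = 1" "lorentz w v = lorentz v w"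
    using v w by (auto simp: hyp_unit_tangent_def hyp_tangent_def lorentz_commute)
  have "w + v \<in> hyp_tangent p" "w - v \<in> hyp_tangent p"
    by (simp_all add: hyp_tangent_def lorentz_bilinear vw)
  then have "w + v = 0 \<or> lorentz (w + v) (w + v) > 0" "w - v = 0 \<or> lorentz (w - v) (w - v) > 0"
    using lorentz_tangent_pos[OF p] by blast+
  moreover have "lorentz (w + v) (w + v) = 2 + 2 * lorentz v w" "lorentz (w - v) (w - v) = 2 - 2 * lorentz v w"
    by (simp_all add: lorentz_bilinear vw)
  moreover have "lorentz 0 0 = 0" by (simp add: lorentz_def)
  ultimately have *: "0 \<le> 2 + 2 * lorentz v w" "0 \<le> 2 - 2 * lorentz v w"
    "w + v = 0 \<or> 0 < 2 + 2 * lorentz v w" "w - v = 0 \<or> 0 < 2 - 2 * lorentz v w"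
    by (metis less_imp_le order_refl)+
  show "\<bar>lorentz v w\<bar> \<le> 1" using * by linarith
  assume "\<bar>lorentz v w\<bar> = 1"
  then have "w + v = 0 \<or> w - v = 0" using * by linarith
  then show "w = v \<or> w = - v" by (auto simp: eq_neg_iff_add_eq_0)
qed

lemma cos_hyp_angle:
  assumes "A \<in> hyp_plane" "B \<in> hyp_plane" "C \<in> hyp_plane" "B \<noteq> A" "B \<noteq> C"
  shows "cos (hyp_angle A B C) = lorentz (hyp_direction B A) (hyp_direction B C)"
  unfolding hyp_angle_def
  using lorentz_unit_tangents_bound(1)[OF assms(2)] hyp_direction_props(1)[OF assms(2)] assms
  by (simp add: cos_arccos_abs)

lemma hyperbolic_law_of_cosines:
  assumes "A \<in> hyp_plane" "B \<in> hyp_plane" "C \<in> hyp_plane" "B \<noteq> A" "B \<noteq> C" "A \<noteq> C"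
  shows "cosh (hyp_dist A C) = cosh (hyp_dist B A) * cosh (hyp_dist B C)
    - sinh (hyp_dist B A) * sinh (hyp_dist B C) * cos (hyp_angle A B C)"
proof -
  let ?v = "hyp_direction B A" and ?w = "hyp_direction B C"
  have v: "?v \<in> hyp_unit_tangent B" and w: "?w \<in> hyp_unit_tangent B"
    using assms by (auto intro: hyp_direction_props)
  have A: "A = hyp_geodesic B ?v (hyp_dist B A)" and C: "C = hyp_geodesic B ?w (hyp_dist B C)"
    using assms by (auto intro: hyp_direction_props)
  have "cosh (hyp_dist A C) = - lorentz A C"
    using lorentz_less_minus_one[OF assms(1,3,6)] by (simp add: hyp_dist_def)
  also have "lorentz A C = lorentz (hyp_geodesic B ?v (hyp_dist B A)) (hyp_geodesic B ?w (hyp_dist B C))"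
    using A C by simp
  also have "\<dots> = - (cosh (hyp_dist B A) * cosh (hyp_dist B C))
      + sinh (hyp_dist B A) * sinh (hyp_dist B C) * lorentz ?v ?w"
    using v w assms(2) lorentz_commute[of ?v B]
    by (simp add: hyp_geodesic_def lorentz_bilinear hyp_unit_tangent_def hyp_tangent_def hyp_plane_def)
  finally show ?thesis using assms by (simp add: cos_hyp_angle)
qed

text \<open>
  For \<open>p = q\<close> a tangent direction is needed as well; it is the direction to any other point of the plane.
\<close>

lemma geodesic_through_two_points:
  assumes "p \<in> hyp_plane" "q \<in> hyp_plane"
  obtains v where "v \<in> hyp_unit_tangent p" "{p, q} \<subseteq> range (hyp_geodesic p v)"
proof -
  have p: "p = hyp_geodesic p v 0" for v by (simp add: hyp_geodesic_def)
  show thesis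
  proof (cases "p = q")
    case False
    then have "q \<in> range (hyp_geodesic p (hyp_direction p q))"
      using hyp_direction_props(2)[OF assms] by blast
    moreover have "p \<in> range (hyp_geodesic p (hyp_direction p q))" using p by blast
    ultimately show ?thesis using that hyp_direction_props(1)[OF assms False] by blast
  next
    case True
    define r :: "real^3" where "r = vector [0, 0, 1]"
    define s :: "real^3" where "s = vector [1, 0, sqrt 2]"
    (* Two points of the plane suffice: one of them differs from p. *)
    have "r \<in> hyp_plane" "s \<in> hyp_plane" "r \<noteq> s"
      by (auto simp: r_def s_def hyp_plane_def lorentz_def vec_eq_iff forall_3)
    then obtain t where "t \<in> hyp_plane" "p \<noteq> t" by metis
    then show ?thesis
      using that[of "hyp_direction p t"] hyp_direction_props(1)[OF assms(1)] p True by blast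
  qed
qed

lemma not_hyp_collinear_imp_distinct:
  assumes "A \<in> hyp_plane" "B \<in> hyp_plane" "C \<in> hyp_plane" "\<not> hyp_collinear {A, B, C}"
  shows "A \<noteq> B" "B \<noteq> C" "A \<noteq> C"
proof -
  have "hyp_collinear {p, q}" if "p \<in> hyp_plane" "q \<in> hyp_plane" for p q
    using geodesic_through_two_points[OF that] that unfolding hyp_collinear_def by metis
  then show "A \<noteq> B" "B \<noteq> C" "A \<noteq> C"
    using assms by (auto simp: insert_commute)
qed

text \<open>
  If the cosine were \<open>1\<close> or \<open>-1\<close>, the two directions at \<open>B\<close> would agree up to sign, and the geodesic
  in this direction would contain all three points.
\<close>

lemma not_hyp_collinear_imp_cos_angle:
  assumes pl: "A \<in> hyp_plane" "B \<in> hyp_plane" "C \<in> hyp_plane" and nc: "\<not> hyp_collinear {A, B, C}"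
  shows "(cos (hyp_angle A B C))\<^sup>2 < 1"
proof (rule ccontr)
  assume not_less: "\<not> ?thesis"
  let ?v = "hyp_direction B A" and ?w = "hyp_direction B C"
  have ne: "B \<noteq> A" "B \<noteq> C" using not_hyp_collinear_imp_distinct[OF assms] by auto
  have v: "?v \<in> hyp_unit_tangent B" and w: "?w \<in> hyp_unit_tangent B"
    using assms ne by (auto intro: hyp_direction_props)
  have "\<bar>lorentz ?v ?w\<bar> = 1"
    using not_less lorentz_unit_tangents_bound(1)[OF pl(2) v w] abs_square_less_1[of "lorentz ?v ?w"]
    by (simp add: cos_hyp_angle[OF pl ne])
  then have "?w = ?v \<or> ?w = - ?v" by (rule lorentz_unit_tangents_bound(2)[OF pl(2) v w])
  moreover have "hyp_geodesic B (- u) t = hyp_geodesic B u (- t)" for u t by (simp add: hyp_geodesic_def)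
  ultimately have "C \<in> range (hyp_geodesic B ?v)"
    using hyp_direction_props(2)[OF pl(2,3) ne(2)] by (metis rangeI)
  moreover have "A \<in> range (hyp_geodesic B ?v)"
    using hyp_direction_props(2)[OF pl(2,1) ne(1)] by blast
  moreover have "B \<in> range (hyp_geodesic B ?v)"
    by (rule range_eqI[of _ _ 0]) (simp add: hyp_geodesic_def)
  ultimately show False using nc pl(2) v unfolding hyp_collinear_def by blast
qed

text \<open>
  The angles determine the sides. The usual form is
  \<open>cos \<alpha> + cos \<beta> cos \<gamma> = cosh a sin \<beta> sin \<gamma>\<close>; its square avoids the signs of the sines. With the
  Gram determinant \<open>D\<close> of the three vertices, up to sign, the law of cosines gives
  \<open>sin\<^sup>2 \<beta> = D / (sinh\<^sup>2 a sinh\<^sup>2 c)\<close>, the analogous formula for \<open>\<gamma>\<close>, and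
  \<open>cos \<alpha> + cos \<beta> cos \<gamma> = D cosh a / (sinh\<^sup>2 a sinh b sinh c)\<close>.
\<close>

lemma hyperbolic_dual_law_of_cosines_squared:
  assumes pl: "A \<in> hyp_plane" "B \<in> hyp_plane" "C \<in> hyp_plane" and nc: "\<not> hyp_collinear {A, B, C}"
  defines "\<alpha> \<equiv> hyp_angle B A C" and "\<beta> \<equiv> hyp_angle A B C" and "\<gamma> \<equiv> hyp_angle A C B"
  shows "(cos \<alpha> + cos \<beta> * cos \<gamma>)\<^sup>2
    = (cosh (hyp_dist B C))\<^sup>2 * ((1 - (cos \<beta>)\<^sup>2) * (1 - (cos \<gamma>)\<^sup>2))"
proof -
  note ne = not_hyp_collinear_imp_distinct[OF assms(1-4)]
  define x y z where "x = cosh (hyp_dist B C)" and "y = cosh (hyp_dist A C)" and "z = cosh (hyp_dist A B)"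
  define p q r where "p = sinh (hyp_dist B C)" and "q = sinh (hyp_dist A C)" and "r = sinh (hyp_dist A B)"
  have s: "p\<^sup>2 = x\<^sup>2 - 1" "q\<^sup>2 = y\<^sup>2 - 1" "r\<^sup>2 = z\<^sup>2 - 1"
    by (simp_all add: x_def y_def z_def p_def q_def r_def cosh_square_eq)
  have nz: "p \<noteq> 0" "q \<noteq> 0" "r \<noteq> 0"
    using hyp_direction_props(3)[OF pl(2,3) ne(2)] hyp_direction_props(3)[OF pl(1,3) ne(3)]
      hyp_direction_props(3)[OF pl(1,2) ne(1)] by (auto simp: p_def q_def r_def)
  have \<alpha>: "r * q * cos \<alpha> = z * y - x"
    using hyperbolic_law_of_cosines[OF pl(2,1,3)] ne
    by (auto simp: \<alpha>_def x_def y_def z_def q_def r_def)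
  have \<beta>: "r * p * cos \<beta> = z * x - y"
    using hyperbolic_law_of_cosines[OF pl(1,2,3)] ne
    by (auto simp: \<beta>_def x_def y_def z_def p_def r_def hyp_dist_commute[of B A])
  have \<gamma>: "q * p * cos \<gamma> = y * x - z"
    using hyperbolic_law_of_cosines[OF pl(1,3,2)] ne
    by (auto simp: \<gamma>_def x_def y_def z_def p_def q_def hyp_dist_commute[of C])
  define D where "D = 1 + 2 * x * y * z - x\<^sup>2 - y\<^sup>2 - z\<^sup>2"
  have 1: "(1 - (cos \<beta>)\<^sup>2) * (p\<^sup>2 * r\<^sup>2) = D"
  proof -
    have "(1 - (cos \<beta>)\<^sup>2) * (p\<^sup>2 * r\<^sup>2) = p\<^sup>2 * r\<^sup>2 - (r * p * cos \<beta>)\<^sup>2" by (simp add: algebra_simps power_mult_distrib)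
    also have "\<dots> = D" unfolding \<beta> s D_def by (simp add: algebra_simps power2_eq_square)
    finally show ?thesis .
  qed
  have 2: "(1 - (cos \<gamma>)\<^sup>2) * (p\<^sup>2 * q\<^sup>2) = D"
  proof -
    have "(1 - (cos \<gamma>)\<^sup>2) * (p\<^sup>2 * q\<^sup>2) = p\<^sup>2 * q\<^sup>2 - (q * p * cos \<gamma>)\<^sup>2" by (simp add: algebra_simps power_mult_distrib)
    also have "\<dots> = D" unfolding \<gamma> s D_def by (simp add: algebra_simps power2_eq_square)
    finally show ?thesis .
  qed
  have 3: "(cos \<alpha> + cos \<beta> * cos \<gamma>) * (p\<^sup>2 * q * r) = x * D"
  proof -
    have "(cos \<alpha> + cos \<beta> * cos \<gamma>) * (p\<^sup>2 * q * r)
        = p\<^sup>2 * (r * q * cos \<alpha>) + (r * p * cos \<beta>) * (q * p * cos \<gamma>)"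
      by (simp add: algebra_simps power2_eq_square)
    also have "\<dots> = x * D" unfolding \<alpha> \<beta> \<gamma> s D_def by (simp add: algebra_simps power2_eq_square)
    finally show ?thesis .
  qed
  have "(cos \<alpha> + cos \<beta> * cos \<gamma>)\<^sup>2 * (p\<^sup>2 * q * r)\<^sup>2 = (x * D)\<^sup>2"
    by (simp only: 3[symmetric] power_mult_distrib)
  also have "\<dots> = x\<^sup>2 * (((1 - (cos \<beta>)\<^sup>2) * (p\<^sup>2 * r\<^sup>2)) * ((1 - (cos \<gamma>)\<^sup>2) * (p\<^sup>2 * q\<^sup>2)))"
    unfolding 1 2 by (simp add: power_mult_distrib power2_eq_square)
  also have "\<dots> = x\<^sup>2 * ((1 - (cos \<beta>)\<^sup>2) * (1 - (cos \<gamma>)\<^sup>2)) * (p\<^sup>2 * q * r)\<^sup>2"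
    by (simp add: power_mult_distrib power2_eq_square mult_ac)
  finally show ?thesis using nz by (simp add: x_def)
qed

lemma algebraic_exp_side_of_rational_angles:
  assumes pl: "A \<in> hyp_plane" "B \<in> hyp_plane" "C \<in> hyp_plane" and nc: "\<not> hyp_collinear {A, B, C}"
    and "rational_angle (hyp_angle B A C)" "rational_angle (hyp_angle A B C)" "rational_angle (hyp_angle A C B)"
  shows "algebraic (exp (hyp_dist B C))"
proof -
  define c1 c2 c3 where c_def: "c1 = cos (hyp_angle B A C)" "c2 = cos (hyp_angle A B C)" "c3 = cos (hyp_angle A C B)"
  define x where "x = cosh (hyp_dist B C)"
  have alg: "algebraic c1" "algebraic c2" "algebraic c3"
    using assms(5-7) unfolding c_def rational_angle_def by (auto intro: algebraic_cos_rational_angle)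
  have alg1: "algebraic (1::real)" by (simp add: rat_imp_algebraic)
  have sq: "algebraic (1 - c\<^sup>2)" if "algebraic c" for c :: real
    using algebraic_real_add[OF alg1, of "- c\<^sup>2"] algebraic_real_mult[OF that that]
    by (auto simp: power2_eq_square)
  have "c2\<^sup>2 < 1" "c3\<^sup>2 < 1"
    using not_hyp_collinear_imp_cos_angle[OF pl nc] not_hyp_collinear_imp_cos_angle[OF pl(1,3,2)] nc
    by (simp_all add: c_def insert_commute)
  then have nz: "(1 - c2\<^sup>2) * (1 - c3\<^sup>2) \<noteq> 0" by auto
  have "(c1 + c2 * c3)\<^sup>2 = x\<^sup>2 * ((1 - c2\<^sup>2) * (1 - c3\<^sup>2))"
    using hyperbolic_dual_law_of_cosines_squared[OF pl nc] by (simp add: c_def x_def)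
  then have "x\<^sup>2 = (c1 + c2 * c3)\<^sup>2 * inverse ((1 - c2\<^sup>2) * (1 - c3\<^sup>2))"
    using nz by (simp add: field_simps)
  moreover have "algebraic ((c1 + c2 * c3)\<^sup>2 * inverse ((1 - c2\<^sup>2) * (1 - c3\<^sup>2)))"
    unfolding power2_eq_square[of "c1 + _"] using alg sq
    by (intro algebraic_real_mult algebraic_real_add algebraic_inverse) auto
  ultimately have x2: "algebraic (x\<^sup>2)" by simp
  have "algebraic (sqrt (x\<^sup>2))" "algebraic (sqrt (x\<^sup>2 - 1))"
    using algebraic_sqrt[OF x2] algebraic_sqrt[OF algebraic_real_add[OF x2 algebraic_minus[OF alg1]]] by simp_all
  moreover have "sqrt (x\<^sup>2) = cosh (hyp_dist B C)" by (simp add: x_def)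
  moreover have "sqrt (x\<^sup>2 - 1) = sinh (hyp_dist B C)"
    using hyp_direction_props(3)[OF pl(2,3)] not_hyp_collinear_imp_distinct[OF pl nc]
    by (simp add: x_def cosh_square_eq)
  ultimately show ?thesis
    using algebraic_real_add by (metis cosh_plus_sinh)
qed

section \<open>Transcendence of the sides\<close>

theorem lemma2p1:
  fixes A B C :: "real^3" and \<alpha> \<beta> \<gamma> :: real
  assumes "A \<in> hyp_plane" and "B \<in> hyp_plane" and "C \<in> hyp_plane"
    and "\<not> hyp_collinear {A, B, C}"
    and "\<alpha> = hyp_angle B A C" and "\<beta> = hyp_angle A B C" and "\<gamma> = hyp_angle A C B"
    and "rational_angle \<alpha>" and "rational_angle \<beta>" and "rational_angle \<gamma>"
  shows "\<not> algebraic (hyp_dist B C) \<and> \<not> algebraic (hyp_dist C A) \<and> \<not> algebraic (hyp_dist A B)"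
proof -
  have side: "\<not> algebraic (hyp_dist Q R)"
    if pl: "P \<in> hyp_plane" "Q \<in> hyp_plane" "R \<in> hyp_plane" and nc: "\<not> hyp_collinear {P, Q, R}"
      and rat: "rational_angle (hyp_angle Q P R)" "rational_angle (hyp_angle P Q R)"
        "rational_angle (hyp_angle P R Q)" for P Q R
  proof
    assume alg: "algebraic (hyp_dist Q R)"
    have "hyp_dist Q R > 0"
      using hyp_direction_props(3) not_hyp_collinear_imp_distinct[OF pl nc] pl by blast
    then have "\<not> algebraic (exp (hyp_dist Q R))" using hermite_lindemann_real[OF alg] by simp
    then show False using algebraic_exp_side_of_rational_angles[OF pl nc rat] by contradiction
  qed
  have perm: "{B, C, A} = {A, B, C}" "{C, A, B} = {A, B, C}" by auto
  show ?thesis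
    using side[of A B C] side[of B C A] side[of C A B] assms
    by (simp add: perm hyp_angle_commute[of C A B] hyp_angle_commute[of C B A] hyp_angle_commute[of B C A])
qed

end
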